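(* Let $\mathcal{V}$ be a Euclidean Jordan algebra of rank $n$ carrying the trace inner product. Suppose $p,r,s\in[1,\infty]$ with $\frac1p=\frac1r+\frac1s$ (with the convention $\frac{1}{\infty}=0$). Then for every linear map $T:\mathcal{V}\to\mathcal{V}$ and every $x\in\mathcal{V}$, $$\|T(x)\|_p\le\|\eta(T)\|_r\,\|x\|_s.$$
   Context: A Euclidean Jordan algebra $(\mathcal{V},\circ,\langle\cdot,\cdot\rangle)$ is a finite-dimensional real inner product space with a bilinear commutative product $\circ$ satisfying the Jordan identity $x\circ(x^2\circ y)=x^2\circ(x\circ y)$ (with $x^2=x\circ x$) and $\langle x\circ y,z\rangle=\langle x,y\circ z\rangle$ for all $x,y,z$, with unit element $e$. If $\mathcal{V}$ has rank $n$, every $x\in\mathcal{V}$ has a spectral decomposition $x=\sum_{i=1}^n x_ie_i$ with $\{e_1,\dots,e_n\}$ a Jordan frame (mutually orthogonal primitive idempotents summing to $e$) and $x_i\in\mathbb{R}$ the eigenvalues of $x$ (uniquely determined up to order). Here $\operatorname{tr}(x)=\sum_i x_i$, and the inner product is the trace inner product $\langle x,y\rangle=\operatorname{tr}(x\circ y)$. The eigenvalue vector $\lambda(x)\in\mathbb{R}^n$ is the vector of eigenvalues of $x$ in decreasing order, and $|x|:=\sum_i|x_i|e_i$. For $r\in[1,\infty]$ and $u\in\mathbb{R}^n$, $\|u\|_r$ is the usual $r$-norm on $\mathbb{R}^n$; for $x\in\mathcal{V}$, the spectral norm is $\|x\|_r:=\|\lambda(x)\|_r$. $(\mathcal{R}^n_+)^{\downarrow}$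 is the set of nonnegative vectors $q\in\mathbb{R}^n$ with $q_1\ge\cdots\ge q_n$. $p*q$ is the componentwise product of vectors, $p^\downarrow$ the decreasing rearrangement. For $p,q\in\mathbb{R}^n$, $p\prec_w q$ (weak majorization) means $\sum_{i=1}^k p_i^\downarrow\le\sum_{i=1}^k q_i^\downarrow$ for all $1\le k\le n$. For a linear map $T$ on $\mathcal{V}$, $\eta(T)$ denotes the unique (existing) vector in $(\mathcal{R}^n_+)^{\downarrow}$ such that $\lambda(|T(x)|)\prec_w\eta(T)*\lambda(|x|)$ for all $x\in\mathcal{V}$, and $\eta(T)\prec_w q$ whenever $q\in(\mathcal{R}^n_+)^{\downarrow}$ satisfies $\lambda(|T(x)|)\prec_w q*\lambda(|x|)$ for all $x\in\mathcal{V}$. *)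

theory Defs
  imports "HOL-Analysis.Analysis"
begin

section \<open>Vectors of \<open>\<real>\<^sup>n\<close>\<close>

text \<open>
  The dimension \<open>n\<close> is the rank of an algebra and hence not available as a type; a vector of
  \<open>\<real>\<^sup>n\<close> is a list of length \<open>n\<close>.
\<close>

definition decr :: "real list \<Rightarrow> real list" where
  "decr u = rev (sort u)"

definition weakly_majorized :: "real list \<Rightarrow> real list \<Rightarrow> bool"  (infix "\<prec>\<^sub>w" 50) where
  "u \<prec>\<^sub>w v \<longleftrightarrow> length u = length v \<and>
     (\<forall>k\<in>{1..length u}. sum_list (take k (decr u)) \<le> sum_list (take k (decr v)))"

definition nonneg_decr :: "nat \<Rightarrow> real list set" where
  "nonneg_decr n = {q. length q = n \<and> (\<forall>i<n. 0 \<le> q ! i) \<and> sorted_wrt (\<ge>) q}"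

definition cw_prod :: "real list \<Rightarrow> real list \<Rightarrow> real list" where
  "cw_prod u v = map2 (*) u v"

definition vec_norm :: "ereal \<Rightarrow> real list \<Rightarrow> real" where
  "vec_norm r u =
     (if r = \<infinity> then Max ((\<lambda>t. \<bar>t\<bar>) ` set u)
      else (\<Sum>i<length u. \<bar>u ! i\<bar> powr real_of_ereal r) powr (1 / real_of_ereal r))"


section \<open>Euclidean Jordan algebras\<close>

locale euclidean_jordan_algebra =
  fixes jp :: "'a::euclidean_space \<Rightarrow> 'a \<Rightarrow> 'a"  (infixl "\<odot>" 70)
    and e :: 'a
  assumes bilinear_jp: "bilinear (\<odot>)"
    and jp_commute: "x \<odot> y = y \<odot> x"
    and jordan_identity: "x \<odot> ((x \<odot> x) \<odot> y) = (x \<odot> x) \<odot> (x \<odot> y)"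
    and inner_jp: "inner (x \<odot> y) z = inner x (y \<odot> z)"
    and unit_jp: "e \<odot> x = x"

primrec jpower :: "('a \<Rightarrow> 'a \<Rightarrow> 'a) \<Rightarrow> 'a \<Rightarrow> 'a \<Rightarrow> nat \<Rightarrow> 'a" where
  "jpower jp e x 0 = e"
| "jpower jp e x (Suc k) = jp x (jpower jp e x k)"

text \<open>
  The degree of the minimal polynomial of \<open>x\<close>, i.e. the least \<open>k > 0\<close> such that the family
  \<open>e, x, \<dots>, x\<^sup>k\<close> is linearly dependent. The rank is the largest such degree.
\<close>

definition minpoly_degree ::
    "('a::euclidean_space \<Rightarrow> 'a \<Rightarrow> 'a) \<Rightarrow> 'a \<Rightarrow> 'a \<Rightarrow> nat" where
  "minpoly_degree jp e x =
     (LEAST k. 0 < k \<and> (\<exists>c :: nat \<Rightarrow> real. (\<exists>i\<le>k. c i \<noteq> 0) \<and>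
        (\<Sum>i\<le>k. c i *\<^sub>R jpower jp e x i) = 0))"

definition jrank :: "('a::euclidean_space \<Rightarrow> 'a \<Rightarrow> 'a) \<Rightarrow> 'a \<Rightarrow> nat" where
  "jrank jp e = Max (range (minpoly_degree jp e))"

definition jidempotent :: "('a \<Rightarrow> 'a \<Rightarrow> 'a) \<Rightarrow> 'a \<Rightarrow> bool" where
  "jidempotent jp c \<longleftrightarrow> jp c c = c"

definition primitive_idempotent :: "('a::euclidean_space \<Rightarrow> 'a \<Rightarrow> 'a) \<Rightarrow> 'a \<Rightarrow> bool" where
  "primitive_idempotent jp c \<longleftrightarrow> jidempotent jp c \<and> c \<noteq> 0 \<and>
     \<not> (\<exists>a b. jidempotent jp a \<and> jidempotent jp b \<and> a \<noteq> 0 \<and> b \<noteq> 0 \<and> c = a + b)"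

definition jordan_frame :: "('a::euclidean_space \<Rightarrow> 'a \<Rightarrow> 'a) \<Rightarrow> 'a \<Rightarrow> 'a list \<Rightarrow> bool" where
  "jordan_frame jp e es \<longleftrightarrow>
     (\<forall>i<length es. primitive_idempotent jp (es ! i)) \<and>
     (\<forall>i<length es. \<forall>j<length es. i \<noteq> j \<longrightarrow> jp (es ! i) (es ! j) = 0) \<and>
     sum_list es = e"

definition spectral_decomposition ::
    "('a::euclidean_space \<Rightarrow> 'a \<Rightarrow> 'a) \<Rightarrow> 'a \<Rightarrow> 'a \<Rightarrow> real list \<Rightarrow> 'a list \<Rightarrow> bool" where
  "spectral_decomposition jp e x xs es \<longleftrightarrow>
     jordan_frame jp e es \<and> length es = jrank jp e \<and> length xs = jrank jp e \<and>
     x = (\<Sum>i<jrank jp e. xs ! i *\<^sub>R es ! i)"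

definition eigvals :: "('a::euclidean_space \<Rightarrow> 'a \<Rightarrow> 'a) \<Rightarrow> 'a \<Rightarrow> 'a \<Rightarrow> real list" where
  "eigvals jp e x =
     (THE l. sorted_wrt (\<ge>) l \<and> (\<exists>es. spectral_decomposition jp e x l es))"

definition jtrace :: "('a::euclidean_space \<Rightarrow> 'a \<Rightarrow> 'a) \<Rightarrow> 'a \<Rightarrow> 'a \<Rightarrow> real" where
  "jtrace jp e x = sum_list (eigvals jp e x)"

definition jabs :: "('a::euclidean_space \<Rightarrow> 'a \<Rightarrow> 'a) \<Rightarrow> 'a \<Rightarrow> 'a \<Rightarrow> 'a" where
  "jabs jp e x =
     (THE y. \<exists>xs es. spectral_decomposition jp e x xs es \<and>
        y = (\<Sum>i<jrank jp e. \<bar>xs ! i\<bar> *\<^sub>R es ! i))"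

definition spectral_norm ::
    "('a::euclidean_space \<Rightarrow> 'a \<Rightarrow> 'a) \<Rightarrow> 'a \<Rightarrow> ereal \<Rightarrow> 'a \<Rightarrow> real" where
  "spectral_norm jp e r x = vec_norm r (eigvals jp e x)"

definition eta_bound ::
    "('a::euclidean_space \<Rightarrow> 'a \<Rightarrow> 'a) \<Rightarrow> 'a \<Rightarrow> ('a \<Rightarrow> 'a) \<Rightarrow> real list \<Rightarrow> bool" where
  "eta_bound jp e T q \<longleftrightarrow> q \<in> nonneg_decr (jrank jp e) \<and>
     (\<forall>x. eigvals jp e (jabs jp e (T x)) \<prec>\<^sub>w cw_prod q (eigvals jp e (jabs jp e x)))"

definition eta ::
    "('a::euclidean_space \<Rightarrow> 'a \<Rightarrow> 'a) \<Rightarrow> 'a \<Rightarrow> ('a \<Rightarrow> 'a) \<Rightarrow> real list" where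
  "eta jp e T = (THE v. eta_bound jp e T v \<and> (\<forall>q. eta_bound jp e T q \<longrightarrow> v \<prec>\<^sub>w q))"

end

theory Submission
  imports Defs
begin

text \<open>
  The inequality splits into three steps. By the choice of \<open>\<eta> = \<eta>(T)\<close>, the eigenvalues of
  \<open>|T x|\<close> are weakly majorized by \<open>\<eta> * \<lambda>(|x|)\<close>; weak majorization of nonnegative decreasing vectors
  passes to \<open>p\<close>-norms because \<open>t \<mapsto> t\<^sup>p\<close> is convex and increasing (\<open>vec_norm_weakly_majorized\<close>); and
  Hoelder's inequality bounds the norm of the product (\<open>holder_vec_norm\<close>). The substance lies in what
  these steps presuppose: that eigenvalues are well defined, and that \<open>\<eta>(T)\<close> exists.

  Spectral theory. The powers of \<open>x\<close> span an associative subalgebra on which multiplication is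
  self-adjoint, so it is spanned by orthogonal idempotents (\<open>associative_subalgebra_idempotents\<close>). A
  linear combination of \<open>m\<close> orthogonal idempotents with distinct coefficients has a minimal polynomial
  of degree \<open>m\<close>; hence no complete orthogonal system has more members than the rank
  (\<open>complete_system_card_le\<close>), and a system of that size consists of primitive idempotents. An element
  whose minimal polynomial has maximal degree has such a system; these elements are dense
  (\<open>regular_dense\<close>), and by compactness the property survives limits, so every element has a
  spectral decomposition (\<open>spectral_system_exists\<close>). The multiplicity of an eigenvalue is
  unique since otherwise exchanging parts of two frames would produce a system larger than the rank
  (\<open>multiplicity_le\<close>).

  Existence of \<open>\<eta>\<close>. Let \<open>S\<^sub>k(x)\<close> be the sum of the \<open>k\<close> largest eigenvalues of \<open>|x|\<close>. It is the maximum
  of \<open>\<langle>x, u\<rangle>\<close> over a set of test vectors \<open>u\<close>, hence convex (\<open>ky_fan_sum_le\<close>). Every \<open>x\<close> is a nonnegative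
  combination of signed partial frame sums \<open>u\<close>, with the gaps of \<open>\<lambda>(|x|)\<close> as coefficients
  (\<open>layer_decomposition\<close>). Therefore \<open>\<lambda>(|T x|) \<prec>\<^sub>w q * \<lambda>(|x|)\<close> needs to be tested only on such \<open>u\<close>, where it
  says \<open>S\<^sub>k(T u) \<le> q\<^sub>1 + \<dots> + q\<^sub>l\<close> with \<open>l\<close> the minimum of \<open>k\<close> and the rank of \<open>u\<close> (\<open>eta_bound_iff\<close>).
  These conditions bound each partial sum of \<open>q\<close> separately from below, and a pointwise infimum of
  concave increasing functions is concave and increasing; so the infima of the partial sums over all
  admissible \<open>q\<close> are the partial sums of an admissible vector, the least one (\<open>eta_exists\<close>).
\<close>

section \<open>Identities in a Jordan algebra\<close>

context euclidean_jordan_algebra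
begin

lemma jp_add_right: "x \<odot> (y + z) = x \<odot> y + x \<odot> z"
  and jp_add_left: "(x + y) \<odot> z = x \<odot> z + y \<odot> z"
  and jp_diff_right: "x \<odot> (y - z) = x \<odot> y - x \<odot> z"
  and jp_diff_left: "(x - y) \<odot> z = x \<odot> z - y \<odot> z"
  and jp_scale_right: "x \<odot> (t *\<^sub>R y) = t *\<^sub>R (x \<odot> y)"
  and jp_scale_left: "(t *\<^sub>R x) \<odot> y = t *\<^sub>R (x \<odot> y)"
  using bilinear_jp
  by (auto simp: bilinear_radd bilinear_ladd bilinear_rsub bilinear_lsub bilinear_rmul bilinear_lmul)

lemma jp_zero_right [simp]: "x \<odot> 0 = 0"
  and jp_zero_left [simp]: "0 \<odot> x = 0"
  using bilinear_jp by (auto simp: bilinear_rzero bilinear_lzero)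

lemma unit_right [simp]: "x \<odot> e = x"
  using unit_jp jp_commute by metis

lemma unit_left [simp]: "e \<odot> x = x"
  by (rule unit_jp)

lemma linear_jp_right: "linear (\<lambda>y. x \<odot> y)"
  by (rule linearI) (simp_all add: jp_add_right jp_scale_right)

lemma linear_jp_left: "linear (\<lambda>x. x \<odot> y)"
  by (rule linearI) (simp_all add: jp_add_left jp_scale_left)

lemma jp_sum_right: "x \<odot> (\<Sum>i\<in>I. f i) = (\<Sum>i\<in>I. x \<odot> f i)"
  using linear_sum[OF linear_jp_right] .

lemma jp_sum_left: "(\<Sum>i\<in>I. f i) \<odot> x = (\<Sum>i\<in>I. f i \<odot> x)"
  using linear_sum[OF linear_jp_left] .

lemmas jp_linear = jp_add_right jp_add_left jp_diff_right jp_diff_left jp_scale_right jp_scale_left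

lemma inner_jp_swap: "inner (a \<odot> x) y = inner x (a \<odot> y)"
  by (metis inner_jp jp_commute)

text \<open>
  The part of the Jordan identity that is linear in \<open>z\<close> when \<open>x\<close> is replaced by \<open>x + z\<close>: the identities
  at \<open>x + z\<close> and \<open>x - z\<close> differ by twice this part and twice the identity at \<open>z\<close>. Pairing with an
  arbitrary vector turns the comparison into real linear arithmetic.
\<close>

lemma jordan_polarized1:
  "z \<odot> ((x \<odot> x) \<odot> y) + 2 *\<^sub>R (x \<odot> ((x \<odot> z) \<odot> y)) =
   (x \<odot> x) \<odot> (z \<odot> y) + 2 *\<^sub>R ((x \<odot> z) \<odot> (x \<odot> y))" (is "?l = ?r")
proof -
  have "inner ?l w = inner ?r w" for w
    using arg_cong[OF jordan_identity[of "x + z" y], of "\<lambda>u. inner u w"]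
      arg_cong[OF jordan_identity[of "x - z" y], of "\<lambda>u. inner u w"]
      arg_cong[OF jordan_identity[of z y], of "\<lambda>u. inner u w"]
    by (simp add: jp_linear inner_add_left inner_diff_left jp_commute[of z x])
  then show ?thesis by (metis vector_eq_rdot)
qed

lemma jordan_polarized2:
  "z \<odot> ((x \<odot> w) \<odot> y) + x \<odot> ((w \<odot> z) \<odot> y) + w \<odot> ((x \<odot> z) \<odot> y) =
   (x \<odot> w) \<odot> (z \<odot> y) + (w \<odot> z) \<odot> (x \<odot> y) + (x \<odot> z) \<odot> (w \<odot> y)" (is "?l = ?r")
proof -
  have "inner ?l v = inner ?r v" for v
    using arg_cong[OF jordan_polarized1[of z "x + w" y], of "\<lambda>u. inner u v"]
      arg_cong[OF jordan_polarized1[of z x y], of "\<lambda>u. inner u v"]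
      arg_cong[OF jordan_polarized1[of z w y], of "\<lambda>u. inner u v"]
    by (simp add: jp_linear inner_add_left inner_diff_left jp_commute[of w x])
  then show ?thesis by (metis vector_eq_rdot)
qed

text \<open>
  The polarized identity, read as an identity between linear maps in the variable \<open>z\<close> that occurs in
  different places of it: multiplication by a triple product is a polynomial in the multiplications by
  its factors and their pairwise products.
\<close>

lemma mult_operator_triple:
  "((x \<odot> w) \<odot> y) \<odot> z =
   (x \<odot> w) \<odot> (y \<odot> z) + (x \<odot> y) \<odot> (w \<odot> z) + (w \<odot> y) \<odot> (x \<odot> z)
     - x \<odot> (y \<odot> (w \<odot> z)) - w \<odot> (y \<odot> (x \<odot> z))"
  using jordan_polarized2[of z x w y]
  by (simp add: jp_commute algebra_simps)

abbreviation pow :: "'a \<Rightarrow> nat \<Rightarrow> 'a" where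
  "pow x n \<equiv> jpower (\<odot>) e x n"

text \<open>
  The triple product \<open>(x\<^sup>n \<odot> x) \<odot> x\<close> gives a recursion that expresses multiplication by any power of
  \<open>x\<close> through the multiplications by \<open>x\<close> and \<open>x \<odot> x\<close>, which commute by the Jordan identity.
\<close>

lemma mult_operator_pow:
  "pow x (Suc (Suc n)) \<odot> z =
   2 *\<^sub>R (pow x (Suc n) \<odot> (x \<odot> z)) + (x \<odot> x) \<odot> (pow x n \<odot> z)
     - pow x n \<odot> (x \<odot> (x \<odot> z)) - x \<odot> (x \<odot> (pow x n \<odot> z))"
proof -
  have 1: "pow x (Suc (Suc n)) = (pow x n \<odot> x) \<odot> x"
    by (simp add: jp_commute)
  have 2: "pow x (Suc n) = pow x n \<odot> x"
    by (simp add: jp_commute)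
  show ?thesis
    unfolding 1 2 mult_operator_triple[of "pow x n" x x z]
    by (simp add: scaleR_2 jp_commute[of x "x \<odot> pow x n"] jp_commute[of x "pow x n"] algebra_simps)
qed

lemma mult_pow_commute:
  "x \<odot> (pow x n \<odot> z) = pow x n \<odot> (x \<odot> z) \<and> (x \<odot> x) \<odot> (pow x n \<odot> z) = pow x n \<odot> ((x \<odot> x) \<odot> z)"
proof (induction n arbitrary: z rule: induct_nat_012)
  case 0
  show ?case by simp
next
  case 1
  show ?case by (simp add: jordan_identity)
next
  case (ge2 n)
  have A: "x \<odot> (pow x n \<odot> z) = pow x n \<odot> (x \<odot> z)"
    "(x \<odot> x) \<odot> (pow x n \<odot> z) = pow x n \<odot> ((x \<odot> x) \<odot> z)" for z
    using ge2.IH(1) by blast+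
  have B: "x \<odot> (pow x (Suc n) \<odot> z) = pow x (Suc n) \<odot> (x \<odot> z)"
    "(x \<odot> x) \<odot> (pow x (Suc n) \<odot> z) = pow x (Suc n) \<odot> ((x \<odot> x) \<odot> z)" for z
    using ge2.IH(2) by blast+
  have C: "(x \<odot> x) \<odot> (x \<odot> z) = x \<odot> ((x \<odot> x) \<odot> z)" for z
    by (simp add: jordan_identity)
  show ?case
    unfolding mult_operator_pow
    by (simp add: jp_linear A B C del: jpower.simps)
qed

lemma pow_add: "pow x m \<odot> pow x n = pow x (m + n)"
proof (induction m)
  case 0
  then show ?case by simp
next
  case (Suc m)
  have "pow x (Suc m) \<odot> pow x n = pow x n \<odot> (x \<odot> pow x m)"
    by (simp add: jp_commute)
  also have "\<dots> = x \<odot> (pow x n \<odot> pow x m)"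
    using mult_pow_commute by metis
  finally show ?case using Suc by (simp add: jp_commute)
qed

section \<open>Idempotents\<close>

lemma peirce_identity:
  assumes "c \<odot> c = c"
  shows "c \<odot> u = 3 *\<^sub>R (c \<odot> (c \<odot> u)) - 2 *\<^sub>R (c \<odot> (c \<odot> (c \<odot> u)))"
proof -
  have 3: "3 *\<^sub>R v = v + v + v" for v :: 'a
  proof -
    have "3 *\<^sub>R v = (1 + 1 + 1) *\<^sub>R v" by simp
    then show ?thesis by (simp only: scaleR_left_distrib scaleR_one)
  qed
  show ?thesis
    using mult_operator_triple[of c c c u] by (simp add: assms scaleR_2 3 diff_diff_eq)
qed

text \<open>
  With \<open>L\<close> the multiplication by \<open>c\<close>, the relation \<open>L = 3 L\<^sup>2 - 2 L\<^sup>3\<close> implies \<open>L = L\<^sup>2 + 4 (L - L\<^sup>2)\<^sup>2\<close>.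
  As \<open>L\<close> is self-adjoint, it is positive semidefinite, and the form vanishes only on its kernel. This
  replaces the Peirce decomposition in all that follows.
\<close>

lemma inner_idempotent:
  assumes "c \<odot> c = c"
  shows "inner (c \<odot> u) u = (norm (c \<odot> u))\<^sup>2 + 4 * (norm (c \<odot> u - c \<odot> (c \<odot> u)))\<^sup>2"
proof -
  \<comment> \<open>Self-adjointness makes these moments depend on \<open>k + l\<close> only; the cubic relation is then a recursion for them.\<close>
  define a where "a k l = inner (((\<odot>) c ^^ k) u) (((\<odot>) c ^^ l) u)" for k l
  have sh: "a (Suc k) l = a k (Suc l)" for k l
    by (simp add: a_def inner_jp_swap)
  have n: "a (Suc k) l = a 0 (Suc k + l)" for k l
    by (induction k arbitrary: l) (auto simp: sh)
  have r: "a 0 (Suc k) = 3 * a 0 (Suc (Suc k)) - 2 * a 0 (Suc (Suc (Suc k)))" for k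
  proof -
    have *: "((\<odot>) c ^^ Suc k) u = 3 *\<^sub>R ((\<odot>) c ^^ Suc (Suc k)) u - 2 *\<^sub>R ((\<odot>) c ^^ Suc (Suc (Suc k))) u"
      using peirce_identity[OF assms, of "((\<odot>) c ^^ k) u"] by simp
    show ?thesis unfolding a_def by (subst *) (simp add: inner_diff_right)
  qed
  have *: "inner (c \<odot> u) u = a (Suc 0) 0" "inner (c \<odot> u) (c \<odot> u) = a (Suc 0) (Suc 0)"
    "inner (c \<odot> u) (c \<odot> (c \<odot> u)) = a (Suc 0) (Suc (Suc 0))"
    "inner (c \<odot> (c \<odot> u)) (c \<odot> (c \<odot> u)) = a (Suc (Suc 0)) (Suc (Suc 0))"
    "inner (c \<odot> (c \<odot> u)) (c \<odot> u) = a (Suc (Suc 0)) (Suc 0)"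
    by (simp_all add: a_def)
  show ?thesis
    unfolding power2_norm_eq_inner inner_diff_left inner_diff_right * n
    using r[of 0] r[of 1] by simp
qed

lemma inner_idempotents_nonneg:
  assumes "c \<odot> c = c" "d \<odot> d = d"
  shows "0 \<le> inner c d"
proof -
  have "inner c d = inner (c \<odot> d) d"
    by (metis assms(2) inner_jp)
  then show ?thesis using inner_idempotent[OF assms(1), of d] by simp
qed

lemma inner_idempotents_zero:
  assumes "c \<odot> c = c" "d \<odot> d = d" "inner c d = 0"
  shows "c \<odot> d = 0"
proof -
  have "inner c d = inner (c \<odot> d) d"
    by (metis assms(2) inner_jp)
  then have "(norm (c \<odot> d))\<^sup>2 + 4 * (norm (c \<odot> d - c \<odot> (c \<odot> d)))\<^sup>2 = 0"
    using inner_idempotent[OF assms(1), of d] assms(3) by simp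
  then show ?thesis
    by (smt (verit) norm_eq_zero power2_eq_square zero_le_power2 power_eq_0_iff)
qed

lemma orthogonal_idempotents_inner:
  assumes "c \<odot> d = 0"
  shows "inner c d = 0"
  by (metis assms inner_jp inner_zero_right unit_right jp_commute)

lemma idempotent_inner_unit:
  assumes "c \<odot> c = c"
  shows "inner c e = (norm c)\<^sup>2"
  by (metis assms inner_jp power2_norm_eq_inner unit_right)

end

section \<open>Eigenvectors and generic linear independence\<close>

text \<open>
  The quadratic form of \<open>f\<close> attains a maximum \<open>l\<close> on the unit sphere of \<open>A\<close>, at \<open>v\<close>. Then \<open>l I - f\<close> is
  positive semidefinite on \<open>A\<close> and its form vanishes at \<open>v\<close>, which puts \<open>v\<close> in its kernel.
\<close>

lemma self_adjoint_eigenvector: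
  fixes f :: "'b::euclidean_space \<Rightarrow> 'b"
  assumes lin: "linear f" and A: "subspace A" "A \<noteq> {0}"
    and inv: "\<And>x. x \<in> A \<Longrightarrow> f x \<in> A"
    and adj: "\<And>x y. x \<in> A \<Longrightarrow> y \<in> A \<Longrightarrow> inner (f x) y = inner x (f y)"
  obtains v l where "v \<in> A" "v \<noteq> 0" "f v = l *\<^sub>R v"
proof -
  define K where "K = sphere 0 1 \<inter> A"
  have "compact K"
    unfolding K_def by (intro compact_Int_closed closed_subspace A compact_sphere)
  obtain a where a: "a \<in> A" "a \<noteq> 0"
    using A subspace_0 by blast
  then have "(1 / norm a) *\<^sub>R a \<in> K"
    using A by (auto simp: K_def subspace_scale)
  then have "K \<noteq> {}" by blast
  have "continuous_on K (\<lambda>x. inner (f x) x)"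
    by (intro continuous_intros linear_continuous_on linear_conv_bounded_linear[THEN iffD1] lin)
  from continuous_attains_sup[OF \<open>compact K\<close> \<open>K \<noteq> {}\<close> this]
  obtain v where v: "v \<in> K" and max: "\<And>y. y \<in> K \<Longrightarrow> inner (f y) y \<le> inner (f v) v" by blast
  define l where "l = inner (f v) v"
  define h where "h y = l *\<^sub>R y - f y" for y
  have vA: "v \<in> A" and nv: "norm v = 1" using v by (auto simp: K_def)
  have hpos: "0 \<le> inner (h y) y" if "y \<in> A" for y
  proof (cases "y = 0")
    case False
    have "(1 / norm y) *\<^sub>R y \<in> K"
      using A that False by (auto simp: K_def subspace_scale)
    from max[OF this] have "inner (f y) y / (norm y)\<^sup>2 \<le> l"
      by (simp add: l_def linear_cmul[OF lin] power2_eq_square)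
    then have "inner (f y) y \<le> l * (norm y)\<^sup>2"
      using False by (simp add: field_simps)
    then show ?thesis
      by (simp add: h_def inner_diff_left power2_norm_eq_inner)
  qed (simp add: h_def)
  have hv: "inner (h v) v = 0"
    using nv by (simp add: h_def inner_diff_left l_def flip: power2_norm_eq_inner)
  define w where "w = h v"
  have wA: "w \<in> A"
    using A vA inv by (auto simp: w_def h_def subspace_diff subspace_scale)
  define W where "W = inner w w"
  define B where "B = inner (h w) w"
  have "0 \<le> B" using hpos wA by (simp add: B_def)
  have quad: "0 \<le> s\<^sup>2 * B - 2 * s * W" for s
  proof -
    have "v - s *\<^sub>R w \<in> A"
      using A vA wA by (simp add: subspace_diff subspace_scale)
    from hpos[OF this] have "0 \<le> inner (h v) v - s * inner (h v) w - s * inner (h w) v + s\<^sup>2 * B"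
      by (simp add: h_def linear_diff[OF lin] linear_cmul[OF lin] B_def inner_diff_left inner_diff_right
          algebra_simps power2_eq_square)
    moreover have "inner (h w) v = inner (h v) w"
      using adj[OF wA vA] by (simp add: h_def inner_diff_left inner_diff_right inner_commute)
    ultimately show ?thesis
      using hv by (simp add: W_def flip: w_def)
  qed
  have "W = 0"
  proof (rule ccontr)
    assume "W \<noteq> 0"
    then have "0 < W" by (simp add: W_def)
    \<comment> \<open>A step against \<open>w = h v\<close> that is short enough for the linear term to dominate.\<close>
    define s where "s = W / (B + 1)"
    have "0 < s" and W: "W = s * (B + 1)"
      using \<open>0 < W\<close> \<open>0 \<le> B\<close> by (auto simp: s_def)
    have "0 \<le> s\<^sup>2 * B - 2 * s * W" by (rule quad)
    also have "\<dots> = s\<^sup>2 * (B - 2 * (B + 1))"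
      by (simp add: W power2_eq_square algebra_simps)
    also have "\<dots> < 0"
      using \<open>0 < s\<close> \<open>0 \<le> B\<close> by (intro mult_pos_neg) auto
    finally show False by simp
  qed
  then have "h v = 0" by (simp add: W_def w_def)
  then have "f v = l *\<^sub>R v" by (simp add: h_def)
  moreover have "v \<noteq> 0" using nv by auto
  ultimately show ?thesis using that vA by blast
qed

text \<open>
  Independence is stated for families since the powers of an element may repeat, and a repetition has
  to count as a dependence.
\<close>

definition indep_family :: "nat \<Rightarrow> (nat \<Rightarrow> 'b::euclidean_space) \<Rightarrow> bool" where
  "indep_family m f \<longleftrightarrow> (\<forall>c::nat \<Rightarrow> real. (\<Sum>i<m. c i *\<^sub>R f i) = 0 \<longrightarrow> (\<forall>i<m. c i = 0))"

lemma indep_family_card_le: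
  assumes "indep_family m f" "finite C" "\<And>i. i < m \<Longrightarrow> f i \<in> span C"
  shows "m \<le> card C"
proof -
  have inj: "inj_on f {..<m}"
  proof (rule inj_onI, rule ccontr)
    fix i j assume ij: "i \<in> {..<m}" "j \<in> {..<m}" "f i = f j" "i \<noteq> j"
    let ?c = "\<lambda>k. (if k = i then 1 else 0) - (if k = j then 1 else 0) :: real"
    have "(\<Sum>k<m. ?c k *\<^sub>R f k) = (\<Sum>k<m. (if k = i then f k else 0)) - (\<Sum>k<m. (if k = j then f k else 0))"
      by (simp only: scaleR_left_diff_distrib sum_subtractf if_distrib[of "\<lambda>t. t *\<^sub>R _"]
          scaleR_one scaleR_zero_left)
    also have "\<dots> = 0" using ij by simp
    finally have "?c i = 0" using assms(1)[unfolded indep_family_def, rule_format, of ?c i] ij(1) by simp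
    then show False using ij by simp
  qed
  have "independent (f ` {..<m})"
  proof (rule independent_if_scalars_zero)
    fix u x assume 0: "(\<Sum>x\<in>f ` {..<m}. u x *\<^sub>R x) = 0" and x: "x \<in> f ` {..<m}"
    have "(\<Sum>i<m. u (f i) *\<^sub>R f i) = 0"
      using 0 by (simp add: sum.reindex[OF inj])
    then show "u x = 0"
      using assms(1)[unfolded indep_family_def, rule_format, of "\<lambda>i. u (f i)"] x by auto
  qed simp
  then have "card (f ` {..<m}) \<le> card C"
    using assms(2,3) by (intro independent_span_bound[THEN conjunct2]) auto
  then show ?thesis by (simp add: card_image[OF inj])
qed

definition polynomial_curve :: "(real \<Rightarrow> 'b::real_inner) \<Rightarrow> bool" where
  "polynomial_curve v \<longleftrightarrow> (\<forall>b. \<exists>p. \<forall>t. inner (v t) b = poly p t)"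

text \<open>
  Linear independence of vectors that depend polynomially on \<open>t\<close> is a nonvanishing condition on a
  polynomial, so if it holds once it fails at finitely many \<open>t\<close> only. Instead of a Gram determinant the
  proof uses Gaussian elimination: a coordinate of \<open>v 0\<close> that is nonzero at \<open>t0\<close> serves as pivot, and
  multiplying through by it, rather than dividing, keeps the remaining vectors polynomial.
\<close>

lemma polynomial_curve_indep_generic:
  assumes "\<And>i. i < m \<Longrightarrow> polynomial_curve (v i)" "indep_family m (\<lambda>i. v i t0)"
  shows "finite {t. \<not> indep_family m (\<lambda>i. v i t)}"
  using assms
proof (induction m arbitrary: v)
  case 0
  then show ?case by (simp add: indep_family_def)
next
  case (Suc m)
  have poly: "\<exists>p. \<forall>t. inner (v i t) b = poly p t" if "i < Suc m" for i b
    using Suc.prems(1)[OF that] by (simp add: polynomial_curve_def)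
  have "v 0 t0 \<noteq> 0"
  proof
    assume "v 0 t0 = 0"
    then have "(\<Sum>i<Suc m. (if i = 0 then 1 else 0) *\<^sub>R v i t0) = 0"
      by (simp del: sum.lessThan_Suc add: sum.lessThan_Suc_shift)
    then show False
      using Suc.prems(2)[unfolded indep_family_def, rule_format, of "\<lambda>i. if i = 0 then 1 else 0" 0]
      by simp
  qed
  define b where "b = v 0 t0"
  define h where "h i t = inner (v i t) b" for i t
  have h0: "h 0 t0 \<noteq> 0" using \<open>v 0 t0 \<noteq> 0\<close> by (simp add: h_def b_def)
  define v' where "v' i t = h 0 t *\<^sub>R v (Suc i) t - h (Suc i) t *\<^sub>R v 0 t" for i t
  have v'sum: "(\<Sum>i<m. c i *\<^sub>R v' i t) =
      h 0 t *\<^sub>R (\<Sum>i<m. c i *\<^sub>R v (Suc i) t) - (\<Sum>i<m. c i * h (Suc i) t) *\<^sub>R v 0 t" for c t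
    by (simp add: v'_def scaleR_right_diff_distrib sum_subtractf scaleR_sum_right scaleR_sum_left
        mult.commute)
  obtain p0 where p0: "\<And>t. h 0 t = poly p0 t"
    using poly[of 0 b] by (auto simp: h_def)
  have "finite {t. \<not> indep_family m (\<lambda>i. v' i t)}"
  proof (rule Suc.IH)
    fix i assume i: "i < m"
    show "polynomial_curve (v' i)"
      unfolding polynomial_curve_def
    proof
      fix d
      obtain p1 p2 p3 where p: "\<And>t. inner (v (Suc i) t) d = poly p1 t"
        "\<And>t. h (Suc i) t = poly p2 t" "\<And>t. inner (v 0 t) d = poly p3 t"
        using poly[of "Suc i" d] poly[of "Suc i" b] poly[of 0 d] i by (auto simp: h_def)
      show "\<exists>p. \<forall>t. inner (v' i t) d = poly p t"
        by (rule exI[of _ "p0 * p1 - p2 * p3"]) (simp add: v'_def inner_diff_left p p0)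
    qed
  next
    show "indep_family m (\<lambda>i. v' i t0)"
      unfolding indep_family_def
    proof (intro allI impI)
      fix c :: "nat \<Rightarrow> real" and i
      assume 0: "(\<Sum>i<m. c i *\<^sub>R v' i t0) = 0" and i: "i < m"
      define c' where "c' k = (case k of 0 \<Rightarrow> - (\<Sum>i<m. c i * h (Suc i) t0) | Suc k \<Rightarrow> h 0 t0 * c k)" for k
      have "(\<Sum>k<Suc m. c' k *\<^sub>R v k t0) = 0"
        using 0 unfolding v'sum
        by (simp del: sum.lessThan_Suc add: sum.lessThan_Suc_shift c'_def scaleR_sum_right)
      then have "c' (Suc i) = 0"
        using Suc.prems(2) i unfolding indep_family_def by blast
      then show "c i = 0" using h0 by (simp add: c'_def)
    qed
  qed
  moreover have "finite {t. h 0 t = 0}"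
    using h0 poly_roots_finite[of p0] unfolding p0 by fastforce
  moreover have "{t. \<not> indep_family (Suc m) (\<lambda>i. v i t)} \<subseteq>
      {t. \<not> indep_family m (\<lambda>i. v' i t)} \<union> {t. h 0 t = 0}"
  proof (clarsimp)
    fix t assume ind: "indep_family m (\<lambda>i. v' i t)" and nz: "h 0 t \<noteq> 0"
      and bad: "\<not> indep_family (Suc m) (\<lambda>i. v i t)"
    have "\<forall>i<Suc m. c i = 0" if 0: "(\<Sum>i<Suc m. c i *\<^sub>R v i t) = 0" for c
    proof -
      have 1: "c 0 *\<^sub>R v 0 t + (\<Sum>i<m. c (Suc i) *\<^sub>R v (Suc i) t) = 0"
        using 0 by (simp del: sum.lessThan_Suc add: sum.lessThan_Suc_shift)
      from arg_cong[OF this, of "\<lambda>u. inner u b"]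
      have 2: "(\<Sum>i<m. c (Suc i) * h (Suc i) t) = - (c 0 * h 0 t)"
        by (simp add: inner_add_left inner_sum_left h_def)
      have "(\<Sum>i<m. c (Suc i) *\<^sub>R v' i t) =
          h 0 t *\<^sub>R (c 0 *\<^sub>R v 0 t + (\<Sum>i<m. c (Suc i) *\<^sub>R v (Suc i) t))"
        unfolding v'sum 2 by (simp add: algebra_simps)
      then have 3: "\<And>i. i < m \<Longrightarrow> c (Suc i) = 0"
        using ind[unfolded indep_family_def, rule_format, of "\<lambda>i. c (Suc i)"] 1 by simp
      then have "c 0 = 0" using 2 nz by simp
      with 3 show ?thesis by (metis less_Suc_eq_0_disj)
    qed
    then show False using bad unfolding indep_family_def by blast
  qed
  ultimately show ?case by (meson finite_UnI finite_subset)
qed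

section \<open>Associative subalgebras\<close>

context euclidean_jordan_algebra
begin

text \<open>
  Induction on the dimension. Multiplication by \<open>a\<close> is self-adjoint, so it has an eigenspace in \<open>A\<close>,
  which is an ideal by associativity. If it is proper, its orthogonal complement is another proper
  ideal, and the two annihilate each other. If no element has a proper eigenspace, every element acts as
  a scalar, so by commutativity \<open>A\<close> is a line, spanned by an idempotent.
\<close>

lemma associative_subalgebra_idempotents:
  assumes "subspace A" "\<And>x y. x \<in> A \<Longrightarrow> y \<in> A \<Longrightarrow> x \<odot> y \<in> A"
    and "\<And>x y z. x \<in> A \<Longrightarrow> y \<in> A \<Longrightarrow> z \<in> A \<Longrightarrow> (x \<odot> y) \<odot> z = x \<odot> (y \<odot> z)"
  shows "\<exists>C. finite C \<and> C \<subseteq> A \<and> A \<subseteq> span C \<and> (\<forall>c\<in>C. c \<odot> c = c \<and> c \<noteq> 0) \<and>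
    (\<forall>c\<in>C. \<forall>d\<in>C. c \<noteq> d \<longrightarrow> c \<odot> d = 0)"
  using assms
proof (induction "dim A" arbitrary: A rule: less_induct)
  case less
  note sub = less.prems(1) and clo = less.prems(2) and ass = less.prems(3)
  consider (zero) "A = {0}"
    | (split) a v b l where "a \<in> A" "v \<in> A" "b \<in> A" "v \<noteq> 0" "a \<odot> v = l *\<^sub>R v" "a \<odot> b \<noteq> l *\<^sub>R b"
    | (scalar) "A \<noteq> {0}" "\<forall>a\<in>A. \<exists>l. \<forall>b\<in>A. a \<odot> b = l *\<^sub>R b"
  proof (cases "A = {0}")
    case nz: False
    show ?thesis
    proof (cases "\<forall>a\<in>A. \<exists>l. \<forall>b\<in>A. a \<odot> b = l *\<^sub>R b")
      case False
      then obtain a where a: "a \<in> A" "\<And>l. \<exists>b\<in>A. a \<odot> b \<noteq> l *\<^sub>R b" by blast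
      obtain v l where "v \<in> A" "v \<noteq> 0" "a \<odot> v = l *\<^sub>R v"
        by (rule self_adjoint_eigenvector[OF linear_jp_right sub nz, of a])
          (use a(1) clo inner_jp_swap in auto)
      then show ?thesis using split a by blast
    qed (use nz scalar in blast)
  qed (use zero in blast)
  then show ?case
  proof cases
    case zero
    then show ?thesis by (intro exI[of _ "{}"]) auto
  next
    case scalar
    then obtain a l where a: "a \<in> A" "a \<noteq> 0" and l: "\<forall>b\<in>A. a \<odot> b = l *\<^sub>R b"
      using sub subspace_0 by blast
    have "inner (a \<odot> a) e = inner a a" by (simp add: inner_jp)
    then have "l \<noteq> 0" using a l by auto
    define c where "c = (1 / l) *\<^sub>R a"
    have "c \<odot> c = c" using \<open>l \<noteq> 0\<close> a l by (simp add: c_def jp_linear)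
    moreover have "c \<noteq> 0" "c \<in> A" using \<open>l \<noteq> 0\<close> a sub by (auto simp: c_def subspace_scale)
    moreover have "b \<in> span {c}" if b: "b \<in> A" for b
    proof -
      obtain m where m: "b \<odot> a = m *\<^sub>R a" using scalar(2) b a(1) by blast
      have "a \<odot> b = l *\<^sub>R b" using l b by simp
      with m have "l *\<^sub>R b = m *\<^sub>R a" by (metis jp_commute)
      then have "(1 / l) *\<^sub>R (l *\<^sub>R b) = m *\<^sub>R c" by (simp add: c_def)
      then have "b = m *\<^sub>R c" using \<open>l \<noteq> 0\<close> by simp
      then show ?thesis by (simp add: span_base span_scale)
    qed
    ultimately show ?thesis by (intro exI[of _ "{c}"]) auto
  next
    case split
    define I where "I = {b \<in> A. a \<odot> b = l *\<^sub>R b}"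
    define J where "J = {b \<in> A. \<forall>i\<in>I. inner b i = 0}"
    have subI: "subspace I" and subJ: "subspace J"
      using sub unfolding subspace_def I_def J_def by (auto simp: jp_linear algebra_simps inner_add_left)
    have IA: "I \<subseteq> A" and JA: "J \<subseteq> A" by (auto simp: I_def J_def)
    have ideal: "x \<odot> i \<in> I" if "x \<in> A" "i \<in> I" for x i
    proof -
      have "a \<odot> (x \<odot> i) = (a \<odot> i) \<odot> x"
        using that ass[of a i x] split IA by (auto simp: jp_commute)
      then show ?thesis using that clo by (auto simp: I_def jp_linear jp_commute)
    qed
    have "b \<notin> I" "v \<in> I" "v \<notin> J" using split by (auto simp: I_def J_def)
    then have "I \<subset> A" "J \<subset> A" using IA JA split by blast+
    then have dims: "dim I < dim A" "dim J < dim A"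
      using subI subJ sub by (auto intro!: dim_psubset simp: span_eq_iff[THEN iffD2])
    have cloJ: "x \<odot> y \<in> J" if "x \<in> J" "y \<in> J" for x y
      using that JA clo ideal by (auto simp: J_def inner_jp)
    have IJ0: "i \<odot> j = 0" if "i \<in> I" "j \<in> J" for i j
    proof -
      have "i \<odot> j \<in> I" using ideal[of j i] that JA by (auto simp: jp_commute)
      moreover have "inner (i \<odot> j) i' = 0" if "i' \<in> I" for i'
      proof -
        have "inner (i \<odot> j) i' = inner j (i \<odot> i')" by (rule inner_jp_swap)
        moreover have "i \<odot> i' \<in> I" using ideal[of i i'] \<open>i \<in> I\<close> IA that by auto
        ultimately show ?thesis using \<open>j \<in> J\<close> by (simp add: J_def)
      qed
      ultimately have "inner (i \<odot> j) (i \<odot> j) = 0" by blast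
      then show ?thesis by simp
    qed
    have cloI: "x \<odot> y \<in> I" if "x \<in> I" "y \<in> I" for x y
      using ideal that IA by blast
    have assI: "(x \<odot> y) \<odot> z = x \<odot> (y \<odot> z)" if "x \<in> I" "y \<in> I" "z \<in> I" for x y z
      using ass that IA by blast
    have assJ: "(x \<odot> y) \<odot> z = x \<odot> (y \<odot> z)" if "x \<in> J" "y \<in> J" "z \<in> J" for x y z
      using ass that JA by blast
    obtain C where C: "finite C" "C \<subseteq> I" "I \<subseteq> span C" "\<forall>c\<in>C. c \<odot> c = c \<and> c \<noteq> 0"
      "\<forall>c\<in>C. \<forall>d\<in>C. c \<noteq> d \<longrightarrow> c \<odot> d = 0"
      using less.hyps[OF dims(1) subI cloI assI] by auto
    obtain D where D: "finite D" "D \<subseteq> J" "J \<subseteq> span D" "\<forall>c\<in>D. c \<odot> c = c \<and> c \<noteq> 0"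
      "\<forall>c\<in>D. \<forall>d\<in>D. c \<noteq> d \<longrightarrow> c \<odot> d = 0"
      using less.hyps[OF dims(2) subJ cloJ assJ] by auto
    have "A \<subseteq> span (C \<union> D)"
    proof
      fix x assume "x \<in> A"
      obtain y z where yz: "y \<in> span I" "\<And>w. w \<in> span I \<Longrightarrow> orthogonal z w" "x = y + z"
        using orthogonal_subspace_decomp_exists[of I x] by metis
      have y: "y \<in> I" using yz(1) subI by (simp add: span_eq_iff[THEN iffD2])
      have "z = x - y" using yz(3) by simp
      then have "z \<in> A" using \<open>x \<in> A\<close> y IA sub by (auto simp: subspace_diff)
      then have "z \<in> J" using yz(2) by (auto simp: J_def orthogonal_def span_base)
      have "y \<in> span (C \<union> D)" using y C(3) span_mono[of C "C \<union> D"] by blast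
      moreover have "z \<in> span (C \<union> D)" using \<open>z \<in> J\<close> D(3) span_mono[of D "C \<union> D"] by blast
      ultimately show "x \<in> span (C \<union> D)" using yz(3) span_add by blast
    qed
    moreover have "\<forall>c\<in>C \<union> D. \<forall>d\<in>C \<union> D. c \<noteq> d \<longrightarrow> c \<odot> d = 0"
    proof (intro ballI impI)
      fix c d assume cd: "c \<in> C \<union> D" "d \<in> C \<union> D" "c \<noteq> d"
      then consider "c \<in> C" "d \<in> C" | "c \<in> D" "d \<in> D" | "c \<in> C" "d \<in> D" | "c \<in> D" "d \<in> C"
        by blast
      then show "c \<odot> d = 0"
        using cd(3) C(2,5) D(2,5) IJ0[of c d] IJ0[of d c] jp_commute[of c d] by cases auto
    qed
    moreover have "finite (C \<union> D)" "C \<union> D \<subseteq> A" "\<forall>c\<in>C \<union> D. c \<odot> c = c \<and> c \<noteq> 0"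
      using C D IA JA by auto
    ultimately show ?thesis by blast
  qed
qed

lemma powers_subalgebra:
  fixes x :: 'a
  defines "A \<equiv> span (range (pow x))"
  shows "u \<in> A \<Longrightarrow> v \<in> A \<Longrightarrow> u \<odot> v \<in> A"
    and "u \<in> A \<Longrightarrow> v \<in> A \<Longrightarrow> w \<in> A \<Longrightarrow> (u \<odot> v) \<odot> w = u \<odot> (v \<odot> w)"
proof -
  have 1: "pow x m \<odot> v \<in> A" if "v \<in> A" for m v
    using that unfolding A_def
  proof (induction rule: span_induct)
    case base
    then show ?case
      by (auto simp: subspace_def jp_linear intro: span_add span_scale span_zero)
  next
    case (step z)
    then show ?case by (auto simp: pow_add intro: span_base)
  qed
  show "u \<odot> v \<in> A" if "u \<in> A" "v \<in> A" for u v
    using that(1) unfolding A_def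
  proof (induction rule: span_induct)
    case base
    then show ?case
      by (auto simp: subspace_def jp_linear intro: span_add span_scale span_zero)
  next
    case (step z)
    then show ?case using 1[OF that(2)] by (auto simp: A_def)
  qed
  have 2: "(pow x m \<odot> pow x n) \<odot> w = pow x m \<odot> (pow x n \<odot> w)" if "w \<in> A" for m n w
    using that unfolding A_def
    by (induction rule: span_induct) (auto simp: subspace_def jp_linear pow_add add.assoc)
  have 3: "(pow x m \<odot> v) \<odot> w = pow x m \<odot> (v \<odot> w)" if "v \<in> A" "w \<in> A" for m v w
    using that(1) unfolding A_def
    by (induction rule: span_induct) (auto simp: subspace_def jp_linear 2 that(2))
  show "(u \<odot> v) \<odot> w = u \<odot> (v \<odot> w)" if "u \<in> A" "v \<in> A" "w \<in> A" for u v w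
    using that(1) unfolding A_def
    by (induction rule: span_induct) (auto simp: subspace_def jp_linear 3 that)
qed

text \<open>
  A Jordan frame without primitivity and indexed by an arbitrary set: the index set varies when
  idempotents are split or when parts of two frames are exchanged.
\<close>

definition complete_system :: "'i set \<Rightarrow> ('i \<Rightarrow> 'a) \<Rightarrow> bool" where
  "complete_system I d \<longleftrightarrow> finite I \<and> (\<forall>i\<in>I. d i \<odot> d i = d i \<and> d i \<noteq> 0) \<and>
     (\<forall>i\<in>I. \<forall>j\<in>I. i \<noteq> j \<longrightarrow> d i \<odot> d j = 0) \<and> (\<Sum>i\<in>I. d i) = e"

lemma powers_complete_system:
  obtains C a where "complete_system C (\<lambda>c. c)" "range (pow x) \<subseteq> span C" "x = (\<Sum>c\<in>C. a c *\<^sub>R c)"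
proof -
  obtain C where C: "finite C" "span (range (pow x)) \<subseteq> span C" "\<forall>c\<in>C. c \<odot> c = c \<and> c \<noteq> 0"
    "\<forall>c\<in>C. \<forall>d\<in>C. c \<noteq> d \<longrightarrow> c \<odot> d = 0"
    using associative_subalgebra_idempotents[of "span (range (pow x))", OF subspace_span
        powers_subalgebra[of _ x]] by auto
  have R: "range (pow x) \<subseteq> span C"
    using C(2) span_superset by blast
  have "e \<in> span C" using R by (metis jpower.simps(1) range_subsetD)
  then obtain u where u: "e = (\<Sum>c\<in>C. u c *\<^sub>R c)"
    using C(1) by (auto simp: span_finite)
  have "u d *\<^sub>R d = d" if d: "d \<in> C" for d
  proof -
    have "d = (\<Sum>c\<in>C. u c *\<^sub>R (c \<odot> d))"
      using unit_left[of d] unfolding u jp_sum_left jp_scale_left by simp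
    also have "\<dots> = (\<Sum>c\<in>C. if c = d then u d *\<^sub>R d else 0)"
      using C d by (intro sum.cong) auto
    finally show ?thesis using C(1) d by simp
  qed
  then have "(\<Sum>c\<in>C. c) = e"
    unfolding u by simp
  then have "complete_system C (\<lambda>c. c)" using C by (simp add: complete_system_def)
  moreover have "pow x 1 \<in> span C" using R by blast
  then have "x \<in> span C" by simp
  then obtain a where "x = (\<Sum>c\<in>C. a c *\<^sub>R c)"
    using C(1) by (auto simp: span_finite)
  ultimately show ?thesis using that R by blast
qed

section \<open>The rank and regular elements\<close>

lemma complete_system_mult:
  assumes "complete_system I d" "i \<in> I"
  shows "(\<Sum>j\<in>I. a j *\<^sub>R d j) \<odot> d i = a i *\<^sub>R d i"
proof -
  have "(\<Sum>j\<in>I. a j *\<^sub>R d j) \<odot> d i = (\<Sum>j\<in>I. if j = i then a i *\<^sub>R d i else 0)"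
    unfolding jp_sum_left using assms by (intro sum.cong) (auto simp: complete_system_def jp_linear)
  then show ?thesis using assms by (simp add: complete_system_def)
qed

lemma complete_system_pow:
  assumes "complete_system I d"
  shows "pow (\<Sum>j\<in>I. a j *\<^sub>R d j) k = (\<Sum>j\<in>I. a j ^ k *\<^sub>R d j)"
proof (induction k)
  case 0
  then show ?case using assms by (simp add: complete_system_def)
next
  case (Suc k)
  show ?case
    by (simp add: Suc jp_sum_right jp_scale_right complete_system_mult[OF assms] mult.commute)
qed

lemma complete_system_coeffs_zero:
  assumes "complete_system I d" "(\<Sum>j\<in>I. a j *\<^sub>R d j) = 0" "i \<in> I"
  shows "a i = 0"
  using complete_system_mult[OF assms(1,3), of a] assms by (auto simp: complete_system_def)

lemma exists_relation:
  "\<exists>c :: nat \<Rightarrow> real. (\<exists>i\<le>DIM('a). c i \<noteq> 0) \<and> (\<Sum>i\<le>DIM('a). c i *\<^sub>R pow x i) = 0"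
proof (rule ccontr)
  assume "\<not> ?thesis"
  then have "indep_family (Suc DIM('a)) (pow x)"
    unfolding indep_family_def lessThan_Suc_atMost less_Suc_eq_le by blast
  then have "Suc DIM('a) \<le> card (Basis :: 'a set)"
    by (rule indep_family_card_le) auto
  then show False by simp
qed

lemma minpoly_degree_le: "minpoly_degree (\<odot>) e x \<le> DIM('a)"
  unfolding minpoly_degree_def by (rule Least_le) (use exists_relation in simp)

lemma minpoly_degree_relation:
  "0 < minpoly_degree (\<odot>) e x \<and> (\<exists>c :: nat \<Rightarrow> real. (\<exists>i\<le>minpoly_degree (\<odot>) e x. c i \<noteq> 0) \<and>
     (\<Sum>i\<le>minpoly_degree (\<odot>) e x. c i *\<^sub>R pow x i) = 0)"
  unfolding minpoly_degree_def by (rule LeastI[of _ "DIM('a)"]) (use exists_relation in simp)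

lemma finite_range_minpoly_degree: "finite (range (minpoly_degree (\<odot>) e))"
  by (rule finite_subset[of _ "{..DIM('a)}"]) (use minpoly_degree_le in auto)

lemma minpoly_degree_le_jrank: "minpoly_degree (\<odot>) e x \<le> jrank (\<odot>) e"
  unfolding jrank_def by (intro Max_ge finite_range_minpoly_degree) auto

lemma jrank_attained: "\<exists>x. minpoly_degree (\<odot>) e x = jrank (\<odot>) e"
  using Max_in[OF finite_range_minpoly_degree] unfolding jrank_def by auto

lemma jrank_pos: "0 < jrank (\<odot>) e"
  using jrank_attained minpoly_degree_relation by metis

lemma unit_nonzero: "e \<noteq> 0"
proof
  assume "e = 0"
  then have "x = 0" for x :: 'a using unit_left[of x] by simp
  then show False by (metis DIM_positive card_gt_0_iff ex_in_conv nonzero_Basis)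
qed

text \<open>
  Giving the members of the system distinct coefficients produces an element \<open>x\<close> at which every
  polynomial acts by evaluation at the coefficients. A polynomial that annihilates \<open>x\<close> has them all as
  roots, so its degree is at least the size of the system.
\<close>

lemma complete_system_card_le:
  assumes "complete_system I d"
  shows "card I \<le> jrank (\<odot>) e"
proof -
  have fin: "finite I" using assms by (simp add: complete_system_def)
  then obtain f :: "'b \<Rightarrow> nat" where f: "inj_on f I"
    using finite_imp_inj_to_nat_seg by metis
  define a where "a i = real (f i)" for i
  have inj: "inj_on a I" using f by (auto simp: a_def inj_on_def)
  define x where "x = (\<Sum>i\<in>I. a i *\<^sub>R d i)"
  define k where "k = minpoly_degree (\<odot>) e x"
  obtain c j where c: "j \<le> k" "c j \<noteq> 0" "(\<Sum>i\<le>k. c i *\<^sub>R pow x i) = 0"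
    using minpoly_degree_relation[of x] by (auto simp: k_def)
  have "(\<Sum>i\<in>I. (\<Sum>l\<le>k. c l * a i ^ l) *\<^sub>R d i) = (\<Sum>l\<le>k. c l *\<^sub>R pow x l)"
    unfolding x_def complete_system_pow[OF assms] scaleR_sum_left scaleR_sum_right
    by (subst sum.swap) simp
  then have "\<And>i. i \<in> I \<Longrightarrow> (\<Sum>l\<le>k. c l * a i ^ l) = 0"
    using complete_system_coeffs_zero[OF assms] c(3) by metis
  then have sub: "a ` I \<subseteq> {z. (\<Sum>l\<le>k. c l * z ^ l) = 0}" by auto
  have "card I = card (a ` I)" by (simp add: card_image[OF inj])
  also have "\<dots> \<le> card {z. (\<Sum>l\<le>k. c l * z ^ l) = 0}"
    using polyfun_rootbound[of k c] c by (intro card_mono sub) auto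
  also have "\<dots> \<le> k" using polyfun_rootbound[of k c] c by auto
  also have "\<dots> \<le> jrank (\<odot>) e" unfolding k_def by (rule minpoly_degree_le_jrank)
  finally show ?thesis .
qed

text \<open>
  The powers span a space of dimension at least the rank, which the orthogonal idempotents of
  \<open>powers_complete_system\<close> span as well; so there are as many of these as the rank allows.
\<close>

lemma regular_complete_system:
  assumes "indep_family (jrank (\<odot>) e) (pow x)"
  obtains d a where "complete_system {..<jrank (\<odot>) e} d" "x = (\<Sum>i<jrank (\<odot>) e. a i *\<^sub>R d i)"
proof -
  obtain C a where C: "complete_system C (\<lambda>c. c)" "range (pow x) \<subseteq> span C" "x = (\<Sum>c\<in>C. a c *\<^sub>R c)"
    using powers_complete_system .
  have fin: "finite C" using C by (simp add: complete_system_def)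
  have "jrank (\<odot>) e \<le> card C"
    using indep_family_card_le[OF assms fin] C(2) by blast
  with complete_system_card_le[OF C(1)] have "card C = jrank (\<odot>) e" by simp
  then obtain d where d: "bij_betw d {..<jrank (\<odot>) e} C"
    using fin ex_bij_betw_nat_finite by (metis atLeast0LessThan)
  have inj: "inj_on d {..<jrank (\<odot>) e}" and im: "d ` {..<jrank (\<odot>) e} = C"
    using d by (auto simp: bij_betw_def)
  have dC: "d i \<in> C" if "i < jrank (\<odot>) e" for i
    using im that by auto
  have "complete_system {..<jrank (\<odot>) e} d"
    unfolding complete_system_def
  proof (intro conjI ballI impI)
    show "d i \<odot> d j = 0" if "i \<in> {..<jrank (\<odot>) e}" "j \<in> {..<jrank (\<odot>) e}" "i \<noteq> j" for i j
    proof -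
      have "d i \<noteq> d j" using inj_onD[OF inj] that by blast
      then show ?thesis using C(1) dC that by (auto simp: complete_system_def)
    qed
    show "(\<Sum>i<jrank (\<odot>) e. d i) = e"
      using C(1) sum.reindex_bij_betw[OF d, of "\<lambda>c. c"] by (simp add: complete_system_def)
  qed (use C(1) dC in \<open>auto simp: complete_system_def\<close>)
  moreover have "x = (\<Sum>i<jrank (\<odot>) e. a (d i) *\<^sub>R d i)"
    using C(3) sum.reindex_bij_betw[OF d, of "\<lambda>c. a c *\<^sub>R c"] by simp
  ultimately show ?thesis using that[of d "\<lambda>i. a (d i)"] by simp
qed

lemma regular_element_exists: "\<exists>x. indep_family (jrank (\<odot>) e) (pow x)"
proof -
  obtain x where x: "minpoly_degree (\<odot>) e x = jrank (\<odot>) e" using jrank_attained by blast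
  obtain k where k: "jrank (\<odot>) e = Suc k" using jrank_pos gr0_implies_Suc by blast
  have "indep_family (Suc k) (pow x)"
  proof (cases "k = 0")
    case True
    then show ?thesis using unit_nonzero by (simp add: indep_family_def)
  next
    case False
    have "k < minpoly_degree (\<odot>) e x" using x k by simp
    then have "\<not> (0 < k \<and> (\<exists>c :: nat \<Rightarrow> real. (\<exists>i\<le>k. c i \<noteq> 0) \<and> (\<Sum>i\<le>k. c i *\<^sub>R pow x i) = 0))"
      unfolding minpoly_degree_def by (rule not_less_Least)
    then show ?thesis
      using False unfolding indep_family_def lessThan_Suc_atMost less_Suc_eq_le by blast
  qed
  then show ?thesis using k by auto
qed

lemma polynomial_curve_pow: "polynomial_curve (\<lambda>t. pow (x + t *\<^sub>R y) k)"
proof (induction k)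
  case 0
  show ?case unfolding polynomial_curve_def
  proof
    fix b
    show "\<exists>p. \<forall>t. inner (pow (x + t *\<^sub>R y) 0) b = poly p t"
      by (rule exI[of _ "[:inner e b:]"]) simp
  qed
next
  case (Suc k)
  show ?case unfolding polynomial_curve_def
  proof
    fix b
    obtain p q where "\<And>t. inner (pow (x + t *\<^sub>R y) k) (x \<odot> b) = poly p t"
      "\<And>t. inner (pow (x + t *\<^sub>R y) k) (y \<odot> b) = poly q t"
      using Suc unfolding polynomial_curve_def by meson
    then have "inner (pow (x + t *\<^sub>R y) (Suc k)) b = poly (p + [:0, 1:] * q) t" for t
      by (simp add: jp_linear inner_add_left inner_jp_swap)
    then show "\<exists>p. \<forall>t. inner (pow (x + t *\<^sub>R y) (Suc k)) b = poly p t" by blast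
  qed
qed

text \<open>
  On the line from \<open>x\<close> to an element whose powers are independent up to the rank, all but finitely many
  points have this property.
\<close>

lemma regular_dense:
  obtains f where "f \<longlonglongrightarrow> x" "\<And>n::nat. indep_family (jrank (\<odot>) e) (pow (f n))"
proof -
  obtain z where z: "indep_family (jrank (\<odot>) e) (pow z)" using regular_element_exists by blast
  define g where "g t = x + t *\<^sub>R (z - x)" for t :: real
  have fin: "finite {t. \<not> indep_family (jrank (\<odot>) e) (pow (g t))}" (is "finite ?B")
    unfolding g_def
    by (rule polynomial_curve_indep_generic[where ?t0.0 = 1]) (use polynomial_curve_pow z in auto)
  have "\<forall>\<^sub>F n in sequentially. inverse (real (Suc n)) \<notin> ?B"
  proof -
    have "inj (\<lambda>n. inverse (real (Suc n)))" by (auto simp: inj_def)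
    then have "finite ((\<lambda>n. inverse (real (Suc n))) -` ?B)" by (intro finite_vimageI fin)
    then have "\<forall>\<^sub>F n in cofinite. inverse (real (Suc n)) \<notin> ?B"
      by (simp add: eventually_cofinite vimage_def)
    then show ?thesis by (simp add: cofinite_eq_sequentially)
  qed
  then obtain N where N: "\<And>n. N \<le> n \<Longrightarrow> inverse (real (Suc n)) \<notin> ?B"
    by (auto simp: eventually_sequentially)
  define f where "f n = g (inverse (real (Suc (n + N))))" for n
  have "(\<lambda>n. inverse (real (Suc (n + N)))) \<longlonglongrightarrow> 0"
    using LIMSEQ_ignore_initial_segment[OF LIMSEQ_inverse_real_of_nat] by simp
  then have "f \<longlonglongrightarrow> x + 0 *\<^sub>R (z - x)"
    unfolding f_def g_def by (intro tendsto_intros)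
  moreover have "indep_family (jrank (\<odot>) e) (pow (f n))" for n
    using N[of "n + N"] by (simp add: f_def)
  ultimately show ?thesis using that by simp
qed

end

section \<open>The spectral theorem\<close>

lemma convergent_subsequence_family:
  fixes g :: "nat \<Rightarrow> nat \<Rightarrow> 'b::euclidean_space"
  assumes "\<And>i. i < m \<Longrightarrow> bounded (range (g i))"
  obtains s :: "nat \<Rightarrow> nat" and l where "strict_mono s" "\<And>i. i < m \<Longrightarrow> (g i \<circ> s) \<longlonglongrightarrow> l i"
  using assms
proof (induction m arbitrary: thesis)
  case 0
  show ?case by (rule 0(1)[of id]) (auto simp: strict_mono_def)
next
  case (Suc m)
  obtain s l where s: "strict_mono s" "\<And>i. i < m \<Longrightarrow> (g i \<circ> s) \<longlonglongrightarrow> l i"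
    using Suc.IH Suc.prems(2) by (metis less_Suc_eq)
  have "range (g m \<circ> s) \<subseteq> range (g m)" by auto
  then have "bounded (range (g m \<circ> s))"
    using Suc.prems(2)[of m] bounded_subset by blast
  then obtain k r where r: "strict_mono r" "((g m \<circ> s) \<circ> r) \<longlonglongrightarrow> k"
    using bounded_imp_convergent_subsequence by metis
  show ?case
  proof (rule Suc.prems(1))
    show "strict_mono (s \<circ> r)" using s(1) r(1) by (rule strict_mono_o)
    fix i assume "i < Suc m"
    then consider "i < m" | "i = m" by linarith
    then show "(g i \<circ> (s \<circ> r)) \<longlonglongrightarrow> (l(m := k)) i"
    proof cases
      case 1
      then show ?thesis
        using LIMSEQ_subseq_LIMSEQ[OF s(2)[OF 1] r(1)] by (simp add: comp_assoc)
    next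
      case 2
      then show ?thesis using r(2) by (simp add: comp_assoc)
    qed
  qed
qed

context euclidean_jordan_algebra
begin

lemma norm_idempotent_le:
  assumes "c \<odot> c = c"
  shows "norm c \<le> norm e"
proof (cases "c = 0")
  case False
  have "norm c * norm c \<le> norm c * norm e"
    using idempotent_inner_unit[OF assms] norm_cauchy_schwarz[of c e] by (simp add: power2_eq_square)
  then show ?thesis using False by simp
qed simp

text \<open>
  A uniform lower bound, so that a limit of nonzero idempotents is nonzero.
\<close>

lemma norm_idempotent_ge:
  obtains \<delta> where "0 < \<delta>" "\<And>c. c \<odot> c = c \<Longrightarrow> c \<noteq> 0 \<Longrightarrow> \<delta> \<le> norm c"
proof -
  obtain B where B: "0 < B" "\<And>x y. norm (x \<odot> y) \<le> B * norm x * norm y"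
    using bilinear_bounded_pos[OF bilinear_jp] by blast
  have "1 / B \<le> norm c" if "c \<odot> c = c" "c \<noteq> 0" for c
  proof -
    have "norm c * 1 \<le> norm c * (B * norm c)"
      using B(2)[of c c] that by (simp add: mult_ac)
    then show ?thesis using that B(1) by (simp add: field_simps)
  qed
  then show ?thesis using that[of "1 / B"] B(1) by simp
qed

lemma tendsto_jp:
  assumes "(f \<longlongrightarrow> x) F" "(g \<longlongrightarrow> y) F"
  shows "((\<lambda>n. f n \<odot> g n) \<longlongrightarrow> x \<odot> y) F"
  using bounded_bilinear.tendsto[OF bilinear_conv_bounded_bilinear[THEN iffD1, OF bilinear_jp] assms] .

lemma complete_system_inner:
  assumes "complete_system I d" "i \<in> I"
  shows "inner (\<Sum>j\<in>I. a j *\<^sub>R d j) (d i) = a i * (norm (d i))\<^sup>2"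
proof -
  have "inner (\<Sum>j\<in>I. a j *\<^sub>R d j) (d i) = inner ((\<Sum>j\<in>I. a j *\<^sub>R d j) \<odot> d i) (d i)"
    using assms by (auto simp: complete_system_def inner_jp)
  then show ?thesis
    by (simp add: complete_system_mult[OF assms] power2_norm_eq_inner)
qed

text \<open>
  The idempotents lie in a bounded set, so along a subsequence they converge, and the limits form a
  system again. The coefficients converge as well because they are recovered from the element by
  pairing it with the idempotents.
\<close>

lemma complete_system_limit:
  fixes m :: nat
  assumes lim: "f \<longlonglongrightarrow> x"
    and sys: "\<And>n. complete_system {..<m} (d n)" "\<And>n. f n = (\<Sum>i<m. a n i *\<^sub>R d n i)"
  shows "\<exists>d a. complete_system {..<m} d \<and> x = (\<Sum>i<m. a i *\<^sub>R d i)"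
proof -
  have idem: "d n i \<odot> d n i = d n i" "d n i \<noteq> 0" if "i < m" for n i
    using sys(1)[of n] that by (auto simp: complete_system_def)
  obtain s c where s: "strict_mono s" and c: "\<And>i. i < m \<Longrightarrow> ((\<lambda>n. d n i) \<circ> s) \<longlonglongrightarrow> c i"
  proof (rule convergent_subsequence_family[of m "\<lambda>i n. d n i"])
    show "bounded (range (\<lambda>n. d n i))" if "i < m" for i
      using norm_idempotent_le idem(1)[OF that] by (auto simp: bounded_iff)
  qed blast
  have c: "(\<lambda>n. d (s n) i) \<longlonglongrightarrow> c i" if "i < m" for i
    using c[OF that] by (simp add: comp_def)
  have f: "(\<lambda>n. f (s n)) \<longlonglongrightarrow> x"
    using LIMSEQ_subseq_LIMSEQ[OF lim s] by (simp add: comp_def)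
  obtain \<delta> where \<delta>: "0 < \<delta>" "\<And>c. c \<odot> c = c \<Longrightarrow> c \<noteq> 0 \<Longrightarrow> \<delta> \<le> norm c"
    using norm_idempotent_ge by blast
  have nz: "c i \<noteq> 0" if "i < m" for i
  proof -
    have "\<delta> \<le> norm (c i)"
      by (rule LIMSEQ_le_const[OF tendsto_norm[OF c[OF that]]]) (use \<delta>(2) idem that in auto)
    then show ?thesis using \<delta>(1) by auto
  qed
  have prod: "c i \<odot> c j = (if i = j then c i else 0)" if "i < m" "j < m" for i j
  proof -
    have "d (s n) i \<odot> d (s n) j = (if i = j then d (s n) i else 0)" for n
      using sys(1)[of "s n"] that by (auto simp: complete_system_def)
    then have "(\<lambda>n. if i = j then d (s n) i else 0) \<longlonglongrightarrow> c i \<odot> c j"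
      using tendsto_jp[OF c[OF that(1)] c[OF that(2)]] by simp
    moreover have "(\<lambda>n. if i = j then d (s n) i else 0) \<longlonglongrightarrow> (if i = j then c i else 0)"
      using c[OF that(1)] by auto
    ultimately show ?thesis by (rule LIMSEQ_unique)
  qed
  have "(\<lambda>n. \<Sum>i<m. d (s n) i) \<longlonglongrightarrow> (\<Sum>i<m. c i)"
    by (intro tendsto_sum c) auto
  moreover have "(\<Sum>i<m. d (s n) i) = e" for n
    using sys(1)[of "s n"] by (simp add: complete_system_def)
  ultimately have "(\<Sum>i<m. c i) = e"
    using LIMSEQ_unique tendsto_const by fastforce
  then have "complete_system {..<m} c"
    using nz prod by (auto simp: complete_system_def)
  moreover have "x = (\<Sum>i<m. (inner x (c i) / (norm (c i))\<^sup>2) *\<^sub>R c i)"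
  proof (rule LIMSEQ_unique)
    have coeff: "inner (f n) (d n i) / (norm (d n i))\<^sup>2 = a n i" if "i < m" for n i
      using complete_system_inner[OF sys(1)[of n], of i "a n"] idem(2)[OF that] that
      by (simp flip: sys(2))
    have "(\<Sum>i<m. (inner (f (s n)) (d (s n) i) / (norm (d (s n) i))\<^sup>2) *\<^sub>R d (s n) i) =
        (\<Sum>i<m. a (s n) i *\<^sub>R d (s n) i)" for n
      by (intro sum.cong refl) (simp add: coeff)
    then have "(\<lambda>n. \<Sum>i<m. (inner (f (s n)) (d (s n) i) / (norm (d (s n) i))\<^sup>2) *\<^sub>R d (s n) i) =
        (\<lambda>n. f (s n))"
      by (simp only: sys(2)[symmetric])
    then show "(\<lambda>n. \<Sum>i<m. (inner (f (s n)) (d (s n) i) / (norm (d (s n) i))\<^sup>2) *\<^sub>R d (s n) i) \<longlonglongrightarrow> x"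
      using f by simp
    show "(\<lambda>n. \<Sum>i<m. (inner (f (s n)) (d (s n) i) / (norm (d (s n) i))\<^sup>2) *\<^sub>R d (s n) i)
      \<longlonglongrightarrow> (\<Sum>i<m. (inner x (c i) / (norm (c i))\<^sup>2) *\<^sub>R c i)"
      by (intro tendsto_intros f c) (use nz in auto)
  qed
  ultimately show ?thesis
    by (intro exI[of _ c] exI[of _ "\<lambda>i. inner x (c i) / (norm (c i))\<^sup>2"]) simp
qed

abbreviation rk :: nat where "rk \<equiv> jrank (\<odot>) e"

theorem spectral_system_exists: "\<exists>d a. complete_system {..<rk} d \<and> x = (\<Sum>i<rk. a i *\<^sub>R d i)"
proof -
  obtain f where f: "f \<longlonglongrightarrow> x" "\<And>n::nat. indep_family rk (pow (f n))"
    using regular_dense[of x] by blast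
  have "\<exists>d a. complete_system {..<rk} d \<and> f n = (\<Sum>i<rk. a i *\<^sub>R d i)" for n
    using regular_complete_system[OF f(2)[of n]] by blast
  then obtain d a where "\<And>n. complete_system {..<rk} (d n)" "\<And>n. f n = (\<Sum>i<rk. a n i *\<^sub>R d n i)"
    by metis
  then show ?thesis by (rule complete_system_limit[OF f(1)])
qed

lemma orthogonal_summand:
  assumes "a \<odot> a = a" "b \<odot> b = b" "d \<odot> d = d" "(a + b) \<odot> d = 0"
  shows "a \<odot> d = 0"
proof -
  have "inner a d + inner b d = 0"
    using orthogonal_idempotents_inner[OF assms(4)] by (simp add: inner_add_left)
  then have "inner a d = 0"
    using inner_idempotents_nonneg[OF assms(1,3)] inner_idempotents_nonneg[OF assms(2,3)] by simp
  then show ?thesis using inner_idempotents_zero assms by blast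
qed

text \<open>
  If a member of a system of maximal size split, the two parts would be orthogonal to each other and to
  the other members, by positivity of the inner product of idempotents, and could replace it in a larger
  system.
\<close>

lemma complete_system_primitive:
  assumes sys: "complete_system {..<rk} d" and i: "i < rk"
  shows "primitive_idempotent (\<odot>) (d i)"
  unfolding primitive_idempotent_def jidempotent_def
proof (intro conjI notI)
  show "d i \<odot> d i = d i" using sys i by (simp add: complete_system_def)
  show "d i = 0 \<Longrightarrow> False" using sys i by (simp add: complete_system_def)
  assume "\<exists>a b. a \<odot> a = a \<and> b \<odot> b = b \<and> a \<noteq> 0 \<and> b \<noteq> 0 \<and> d i = a + b"
  then obtain a b where ab: "a \<odot> a = a" "b \<odot> b = b" "a \<noteq> 0" "b \<noteq> 0" "d i = a + b" by blast
  have "(a + b) \<odot> (a + b) = a + b" using sys i ab(5) by (metis complete_system_def lessThan_iff)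
  then have "2 *\<^sub>R (a \<odot> b) = 0"
    using ab jp_commute[of b a] by (simp add: jp_linear scaleR_2 algebra_simps)
  then have ab0: "a \<odot> b = 0" by simp
  have orth: "a \<odot> d j = 0" "b \<odot> d j = 0" if "j < rk" "j \<noteq> i" for j
  proof -
    have "d j \<odot> d j = d j" "(a + b) \<odot> d j = 0" "(b + a) \<odot> d j = 0"
      using sys that i by (auto simp: complete_system_def add.commute simp flip: ab(5))
    then show "a \<odot> d j = 0" "b \<odot> d j = 0"
      using orthogonal_summand ab(1,2) by blast+
  qed
  define d' where "d' = d(i := a, rk := b)"
  have sum: "(\<Sum>j<Suc rk. d' j) = e"
  proof -
    have "(\<Sum>j<rk. d' j) = d' i + (\<Sum>j\<in>{..<rk} - {i}. d' j)"
      using i by (intro sum.remove) auto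
    also have "(\<Sum>j\<in>{..<rk} - {i}. d' j) = (\<Sum>j\<in>{..<rk} - {i}. d j)"
      by (intro sum.cong) (auto simp: d'_def)
    also have "\<dots> = e - d i"
      using sum.remove[of "{..<rk}" i d] i sys by (simp add: complete_system_def algebra_simps)
    finally show ?thesis using i ab(5) by (simp add: d'_def)
  qed
  have "complete_system {..<Suc rk} d'"
    unfolding complete_system_def
  proof (intro conjI ballI impI)
    fix j k assume "j \<in> {..<Suc rk}" "k \<in> {..<Suc rk}" "j \<noteq> k"
    then show "d' j \<odot> d' k = 0"
      using sys i ab0 orth jp_commute[of b a] jp_commute[of "d j" a] jp_commute[of "d j" b]
      by (auto simp: d'_def complete_system_def less_Suc_eq)
  qed (use sys i ab sum in \<open>auto simp: d'_def complete_system_def less_Suc_eq\<close>)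
  from complete_system_card_le[OF this] show False by simp
qed

lemma jordan_frame_iff:
  "jordan_frame (\<odot>) e es \<and> length es = rk \<longleftrightarrow> complete_system {..<rk} (\<lambda>i. es ! i) \<and> length es = rk"
proof -
  have "sum_list es = (\<Sum>i<length es. es ! i)"
    by (simp add: sum_list_sum_nth atLeast0LessThan)
  then have "jordan_frame (\<odot>) e es \<longleftrightarrow> complete_system {..<rk} (\<lambda>i. es ! i)" if "length es = rk"
    using complete_system_primitive[of "\<lambda>i. es ! i"] that unfolding jordan_frame_def
    by (auto simp: complete_system_def primitive_idempotent_def jidempotent_def simp del: not_ex)
  then show ?thesis by blast
qed

lemma spectral_decomposition_iff:
  "spectral_decomposition (\<odot>) e x xs es \<longleftrightarrow> complete_system {..<rk} (\<lambda>i. es ! i) \<and> length es = rk \<and>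
     length xs = rk \<and> x = (\<Sum>i<rk. xs ! i *\<^sub>R es ! i)"
  unfolding spectral_decomposition_def using jordan_frame_iff[of es] by blast

lemma spectral_decomposition_exists: "\<exists>xs es. spectral_decomposition (\<odot>) e x xs es"
proof -
  obtain d a where d: "complete_system {..<rk} d" "x = (\<Sum>i<rk. a i *\<^sub>R d i)"
    using spectral_system_exists by blast
  have "complete_system {..<rk} (\<lambda>i. map d [0..<rk] ! i)"
    using d(1) by (simp add: complete_system_def)
  then show ?thesis
    unfolding spectral_decomposition_iff using d(2)
    by (intro exI[of _ "map a [0..<rk]"] exI[of _ "map d [0..<rk]"]) simp
qed

section \<open>Uniqueness of eigenvalues\<close>

text \<open>
  Members of two systems that diagonalize the same element are eigenvectors of a self-adjoint map, so
  distinct eigenvalues make them orthogonal; for idempotents this means that the product vanishes.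
\<close>

lemma eigenvectors_orthogonal:
  assumes "complete_system I c" "complete_system J d"
    and "(\<Sum>i\<in>I. a i *\<^sub>R c i) = (\<Sum>j\<in>J. b j *\<^sub>R d j)" (is "?x = _")
    and "i \<in> I" "j \<in> J" "a i \<noteq> b j"
  shows "c i \<odot> d j = 0"
proof -
  have "?x \<odot> c i = a i *\<^sub>R c i" "?x \<odot> d j = b j *\<^sub>R d j"
    using complete_system_mult[OF assms(1,4), of a] complete_system_mult[OF assms(2,5), of b] assms(3)
    by simp_all
  then have "a i * inner (c i) (d j) = b j * inner (c i) (d j)"
    using inner_jp_swap[of ?x "c i" "d j"] by simp
  then have "inner (c i) (d j) = 0" using assms(6) by simp
  then show ?thesis
    using inner_idempotents_zero[of "c i" "d j"] assms(1,2,4,5) by (auto simp: complete_system_def)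
qed

text \<open>
  Both sides agree with the double sum over \<open>c i \<odot> d j\<close>, in which only the terms with equal eigenvalues
  survive. With indicator functions this identifies eigenprojections, with the absolute value it makes
  \<open>jabs\<close> well defined.
\<close>

lemma functional_calculus_unique:
  fixes \<phi> :: "real \<Rightarrow> real"
  assumes "complete_system I c" "complete_system J d"
    and "(\<Sum>i\<in>I. a i *\<^sub>R c i) = (\<Sum>j\<in>J. b j *\<^sub>R d j)"
  shows "(\<Sum>i\<in>I. \<phi> (a i) *\<^sub>R c i) = (\<Sum>j\<in>J. \<phi> (b j) *\<^sub>R d j)"
proof -
  have sums: "(\<Sum>i\<in>I. c i) = e" "(\<Sum>j\<in>J. d j) = e"
    using assms by (auto simp: complete_system_def)
  have "(\<Sum>i\<in>I. \<phi> (a i) *\<^sub>R c i) = (\<Sum>i\<in>I. \<phi> (a i) *\<^sub>R c i) \<odot> (\<Sum>j\<in>J. d j)"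
    by (simp add: sums)
  also have "\<dots> = (\<Sum>i\<in>I. \<Sum>j\<in>J. \<phi> (a i) *\<^sub>R (c i \<odot> d j))"
    by (simp only: jp_sum_left jp_scale_left) (simp only: jp_sum_right scaleR_sum_right)
  also have "\<dots> = (\<Sum>i\<in>I. \<Sum>j\<in>J. \<phi> (b j) *\<^sub>R (c i \<odot> d j))"
    by (intro sum.cong refl) (metis eigenvectors_orthogonal[OF assms] scaleR_zero_right)
  also have "\<dots> = (\<Sum>i\<in>I. c i) \<odot> (\<Sum>j\<in>J. \<phi> (b j) *\<^sub>R d j)"
    by (simp only: jp_sum_left) (simp only: jp_sum_right jp_scale_right)
  finally show ?thesis by (simp add: sums)
qed

text \<open>
  The eigenprojections at \<open>t\<close> agree. So in the first system, the members with eigenvalue \<open>t\<close> can be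
  exchanged for those of the second, and the result cannot be larger than the rank.
\<close>

lemma multiplicity_le:
  assumes sys: "complete_system I c" "complete_system J d" and "card I = rk"
    and eq: "(\<Sum>i\<in>I. a i *\<^sub>R c i) = (\<Sum>j\<in>J. b j *\<^sub>R d j)"
  shows "card {j\<in>J. b j = t} \<le> card {i\<in>I. a i = t}"
proof -
  have fin: "finite I" "finite J" using sys by (auto simp: complete_system_def)
  define K where "K = {i\<in>I. a i \<noteq> t} <+> {j\<in>J. b j = t}"
  have split: "(\<Sum>k\<in>K. case_sum c d k) = (\<Sum>i | i \<in> I \<and> a i \<noteq> t. c i) + (\<Sum>j | j \<in> J \<and> b j = t. d j)"
    unfolding K_def using fin by (subst sum.Plus) auto
  have "(\<Sum>j | j \<in> J \<and> b j = t. d j) = (\<Sum>j\<in>J. (if b j = t then 1 else 0) *\<^sub>R d j)"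
    using fin by (simp add: sum.inter_filter if_distrib[of "\<lambda>s. s *\<^sub>R _"] cong: if_cong)
  also have "\<dots> = (\<Sum>i\<in>I. (if a i = t then 1 else 0) *\<^sub>R c i)"
    using functional_calculus_unique[OF sys eq, of "\<lambda>s. if s = t then 1 else 0"] by simp
  also have "\<dots> = (\<Sum>i | i \<in> I \<and> a i = t. c i)"
    using fin by (simp add: sum.inter_filter if_distrib[of "\<lambda>s. s *\<^sub>R _"] cong: if_cong)
  finally have "(\<Sum>k\<in>K. case_sum c d k) = (\<Sum>i | i \<in> I \<and> a i \<noteq> t. c i) + (\<Sum>i | i \<in> I \<and> a i = t. c i)"
    using split by simp
  also have "\<dots> = (\<Sum>i\<in>I. c i)"
    using fin(1) by (subst sum.union_disjoint[symmetric]) (auto intro!: sum.cong)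
  also have "\<dots> = e" using sys(1) by (simp add: complete_system_def)
  finally have sum: "(\<Sum>k\<in>K. case_sum c d k) = e" .
  have orth: "c i \<odot> d j = 0" "d j \<odot> c i = 0" if "i \<in> I" "a i \<noteq> t" "j \<in> J" "b j = t" for i j
    using eigenvectors_orthogonal[OF sys eq that(1,3)] that jp_commute[of "d j" "c i"] by auto
  have "complete_system K (case_sum c d)"
    unfolding complete_system_def
  proof (intro conjI ballI impI)
    show "case_sum c d k \<odot> case_sum c d l = 0" if "k \<in> K" "l \<in> K" "k \<noteq> l" for k l
      using that sys orth unfolding K_def complete_system_def by (cases k; cases l) auto
  qed (use sys sum fin in \<open>auto simp: K_def complete_system_def\<close>)
  from complete_system_card_le[OF this]
  have "card {i\<in>I. a i \<noteq> t} + card {j\<in>J. b j = t} \<le> card I"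
    using fin assms(3) by (simp add: K_def card_Plus)
  moreover have "card I = card {i\<in>I. a i \<noteq> t} + card {i\<in>I. a i = t}"
    using fin(1) by (subst card_Un_disjoint[symmetric]) (auto intro!: arg_cong[where f = card])
  ultimately show ?thesis by simp
qed

lemma spectral_decomposition_unique:
  assumes "spectral_decomposition (\<odot>) e x xs es" "spectral_decomposition (\<odot>) e x ys fs"
  shows "mset xs = mset ys"
proof (rule multiset_eqI)
  fix t
  have cnt: "count (mset zs) t = card {i\<in>{..<length zs}. zs ! i = t}" for zs :: "real list"
  proof -
    have "count (mset zs) t = length (filter (\<lambda>z. z = t) zs)"
      by (induction zs) auto
    then show ?thesis by (simp add: length_filter_conv_card)
  qed
  show "count (mset xs) t = count (mset ys) t"
    using multiplicity_le[of "{..<rk}" "\<lambda>i. es ! i" "{..<rk}" "\<lambda>i. fs ! i" "\<lambda>i. xs ! i" "\<lambda>i. ys ! i" t]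
      multiplicity_le[of "{..<rk}" "\<lambda>i. fs ! i" "{..<rk}" "\<lambda>i. es ! i" "\<lambda>i. ys ! i" "\<lambda>i. xs ! i" t]
      assms
    unfolding cnt spectral_decomposition_iff by simp
qed

text \<open>
  Since eigenvalues may be listed in any order, they can be sorted, by value for \<open>eigvals\<close> and by absolute
  value below.
\<close>

lemma spectral_decomposition_reorder:
  assumes "spectral_decomposition (\<odot>) e x xs es" "mset ys = mset xs"
  shows "\<exists>fs. spectral_decomposition (\<odot>) e x ys fs"
proof -
  obtain p where p: "p permutes {..<length xs}" "permute_list p xs = ys"
    using mset_eq_permutation[OF assms(2)] .
  have len: "length xs = rk" "length es = rk" and sys: "complete_system {..<rk} (\<lambda>i. es ! i)"
    and x: "x = (\<Sum>i<rk. xs ! i *\<^sub>R es ! i)"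
    using assms(1) by (auto simp: spectral_decomposition_iff)
  have bij: "bij_betw p {..<rk} {..<rk}" using p(1) len by (simp add: permutes_imp_bij)
  have pr: "p i < rk" if "i < rk" for i using bij that by (auto simp: bij_betw_def)
  have inj: "p i \<noteq> p j" if "i \<noteq> j" for i j using permutes_inj[OF p(1)] that by (auto simp: inj_def)
  have nth: "permute_list p xs ! i = xs ! p i" "permute_list p es ! i = es ! p i" if "i < rk" for i
    using p(1) len that by (simp_all add: permute_list_nth)
  have "(\<Sum>i<rk. es ! p i) = e"
    using sum.reindex_bij_betw[OF bij, of "\<lambda>i. es ! i"] sys by (simp add: complete_system_def)
  then have "complete_system {..<rk} (\<lambda>i. permute_list p es ! i)"
    using sys pr inj by (auto simp: complete_system_def nth)
  moreover have "x = (\<Sum>i<rk. permute_list p xs ! i *\<^sub>R permute_list p es ! i)"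
    using x sum.reindex_bij_betw[OF bij, of "\<lambda>i. xs ! i *\<^sub>R es ! i"] by (simp add: nth)
  ultimately have "spectral_decomposition (\<odot>) e x ys (permute_list p es)"
    using p(2) len by (auto simp: spectral_decomposition_iff)
  then show ?thesis by blast
qed

end

section \<open>Eigenvalue vectors\<close>

lemma mset_decr [simp]: "mset (decr u) = mset u"
  by (simp add: decr_def)

lemma sorted_decr: "sorted_wrt (\<ge>) (decr u)"
  by (simp add: decr_def sorted_wrt_rev)

lemma decr_eqI:
  assumes "mset v = mset u" "sorted_wrt (\<ge>) v"
  shows "decr u = v"
proof -
  have "sorted (rev v)" using assms(2) by (simp add: sorted_wrt_rev)
  then have "sort u = rev v" using assms(1) by (intro properties_for_sort) simp
  then show ?thesis by (simp add: decr_def)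
qed

context euclidean_jordan_algebra
begin

lemma eigvals_eq:
  assumes "spectral_decomposition (\<odot>) e x xs es"
  shows "eigvals (\<odot>) e x = decr xs"
  unfolding eigvals_def
proof (rule the_equality)
  show "sorted_wrt (\<ge>) (decr xs) \<and> (\<exists>es. spectral_decomposition (\<odot>) e x (decr xs) es)"
    using spectral_decomposition_reorder[OF assms] by (simp add: sorted_decr)
  show "l = decr xs" if "sorted_wrt (\<ge>) l \<and> (\<exists>es. spectral_decomposition (\<odot>) e x l es)" for l
    using that spectral_decomposition_unique[OF assms] decr_eqI[of l xs] by auto
qed

lemma jabs_eq:
  assumes "spectral_decomposition (\<odot>) e x xs es"
  shows "jabs (\<odot>) e x = (\<Sum>i<rk. \<bar>xs ! i\<bar> *\<^sub>R es ! i)"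
  unfolding jabs_def
proof (rule the_equality)
  show "\<exists>ys fs. spectral_decomposition (\<odot>) e x ys fs \<and>
      (\<Sum>i<rk. \<bar>xs ! i\<bar> *\<^sub>R es ! i) = (\<Sum>i<rk. \<bar>ys ! i\<bar> *\<^sub>R fs ! i)"
    using assms by blast
  fix y assume "\<exists>ys fs. spectral_decomposition (\<odot>) e x ys fs \<and> y = (\<Sum>i<rk. \<bar>ys ! i\<bar> *\<^sub>R fs ! i)"
  then obtain ys fs where y: "spectral_decomposition (\<odot>) e x ys fs" "y = (\<Sum>i<rk. \<bar>ys ! i\<bar> *\<^sub>R fs ! i)"
    by blast
  show "y = (\<Sum>i<rk. \<bar>xs ! i\<bar> *\<^sub>R es ! i)"
    unfolding y(2)
    by (rule functional_calculus_unique) (use assms y(1) in \<open>auto simp: spectral_decomposition_iff\<close>)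
qed

lemma spectral_decomposition_jabs:
  assumes "spectral_decomposition (\<odot>) e x xs es"
  shows "spectral_decomposition (\<odot>) e (jabs (\<odot>) e x) (map abs xs) es"
  using assms jabs_eq[OF assms] by (auto simp: spectral_decomposition_iff)

abbreviation abs_eigvals :: "'a \<Rightarrow> real list" where
  "abs_eigvals x \<equiv> eigvals (\<odot>) e (jabs (\<odot>) e x)"

lemma abs_eigvals_eq:
  assumes "spectral_decomposition (\<odot>) e x xs es"
  shows "abs_eigvals x = decr (map abs xs)"
  using eigvals_eq[OF spectral_decomposition_jabs[OF assms]] .

lemma mset_abs_eigvals: "mset (abs_eigvals x) = mset (map abs (eigvals (\<odot>) e x))"
proof -
  obtain xs es where "spectral_decomposition (\<odot>) e x xs es"
    using spectral_decomposition_exists by blast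
  then show ?thesis by (simp add: abs_eigvals_eq eigvals_eq)
qed

lemma abs_sorted_decomposition:
  obtains xs es where "spectral_decomposition (\<odot>) e x xs es" "map abs xs = abs_eigvals x"
proof -
  obtain xs es where d: "spectral_decomposition (\<odot>) e x xs es"
    using spectral_decomposition_exists by blast
  define ys where "ys = rev (sort_key abs xs)"
  have "mset ys = mset xs" by (simp add: ys_def)
  then obtain fs where fs: "spectral_decomposition (\<odot>) e x ys fs"
    using spectral_decomposition_reorder[OF d] by blast
  have "sorted (map abs (sort_key abs xs))" by (rule sorted_sort_key)
  then have "sorted_wrt (\<ge>) (map abs ys)"
    by (simp add: ys_def sorted_wrt_rev rev_map[symmetric])
  then have "map abs ys = abs_eigvals x"
    using abs_eigvals_eq[OF fs] decr_eqI[of "map abs ys" "map abs ys"] by simp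
  with fs that show ?thesis by blast
qed

lemma abs_eigvals_nonneg_decr: "abs_eigvals x \<in> nonneg_decr rk"
proof -
  obtain xs es where d: "spectral_decomposition (\<odot>) e x xs es" "map abs xs = abs_eigvals x"
    using abs_sorted_decomposition .
  have "sorted_wrt (\<ge>) (abs_eigvals x)"
    using abs_eigvals_eq[OF d(1)] sorted_decr by metis
  moreover have "length xs = rk" using d(1) by (simp add: spectral_decomposition_iff)
  ultimately show ?thesis
    unfolding nonneg_decr_def d(2)[symmetric] by simp
qed

end

section \<open>Partial sums and weak majorization\<close>

lemma sum_list_take: "k \<le> length l \<Longrightarrow> sum_list (take k l) = (\<Sum>i<k. l ! i)"
  for l :: "real list"
  by (simp add: sum_list_sum_nth atLeast0LessThan)

lemma nonneg_decr_iff: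
  "q \<in> nonneg_decr n \<longleftrightarrow> length q = n \<and> (\<forall>i<n. 0 \<le> q ! i) \<and> (\<forall>i j. i \<le> j \<longrightarrow> j < n \<longrightarrow> q ! j \<le> q ! i)"
  unfolding nonneg_decr_def sorted_wrt_iff_nth_less
  by (auto simp: le_less)

lemma cw_prod_length [simp]: "length (cw_prod u v) = min (length u) (length v)"
  by (simp add: cw_prod_def)

lemma cw_prod_nth: "i < length u \<Longrightarrow> i < length v \<Longrightarrow> cw_prod u v ! i = u ! i * v ! i"
  by (simp add: cw_prod_def)

lemma cw_prod_nonneg_decr:
  assumes "u \<in> nonneg_decr n" "v \<in> nonneg_decr n"
  shows "cw_prod u v \<in> nonneg_decr n"
  using assms unfolding nonneg_decr_iff
  by (auto simp: cw_prod_nth intro!: mult_mono)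

lemma decr_nonneg_decr: "u \<in> nonneg_decr n \<Longrightarrow> decr u = u"
  by (auto simp: nonneg_decr_def intro!: decr_eqI)

lemma weakly_majorized_iff:
  assumes "u \<in> nonneg_decr n" "v \<in> nonneg_decr n"
  shows "u \<prec>\<^sub>w v \<longleftrightarrow> (\<forall>k\<in>{1..n}. (\<Sum>i<k. u ! i) \<le> (\<Sum>i<k. v ! i))"
proof -
  have "length u = n" "length v = n" using assms by (auto simp: nonneg_decr_iff)
  then show ?thesis
    by (simp add: weakly_majorized_def decr_nonneg_decr[OF assms(1)] decr_nonneg_decr[OF assms(2)]
        sum_list_take)
qed

lemma weakly_majorized_antisym:
  assumes "u \<in> nonneg_decr n" "v \<in> nonneg_decr n" "u \<prec>\<^sub>w v" "v \<prec>\<^sub>w u"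
  shows "u = v"
proof (rule nth_equalityI)
  show "length u = length v" using assms by (auto simp: nonneg_decr_iff)
  fix i assume "i < length u"
  then have i: "i < n" using assms by (auto simp: nonneg_decr_iff)
  have eq: "(\<Sum>i<k. u ! i) = (\<Sum>i<k. v ! i)" if "k \<le> n" for k
  proof (cases "k = 0")
    case False
    then show ?thesis
      using assms(3,4) that weakly_majorized_iff[OF assms(1,2)] weakly_majorized_iff[OF assms(2,1)]
      by (intro antisym) auto
  qed simp
  show "u ! i = v ! i"
    using eq[of i] eq[of "Suc i"] i by simp
qed

text \<open>
  Used in two ways: with vectors, to write an element as a combination of partial frame sums, and with
  real numbers, to compare weighted sums through partial sums. If \<open>\<mu>\<close> is decreasing with \<open>\<mu> n = 0\<close>, the
  coefficients are nonnegative and the last term vanishes.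
\<close>

lemma abel_summation:
  fixes v :: "nat \<Rightarrow> 'b::real_vector" and \<mu> :: "nat \<Rightarrow> real"
  shows "(\<Sum>i<n. \<mu> i *\<^sub>R v i) = (\<Sum>j<n. (\<mu> j - \<mu> (Suc j)) *\<^sub>R (\<Sum>i<Suc j. v i)) + \<mu> n *\<^sub>R (\<Sum>i<n. v i)"
  by (induction n) (simp_all add: algebra_simps)

text \<open>
  Comparison with a threshold \<open>m\<close> that separates the first \<open>k\<close> values of \<open>\<mu>\<close> from the rest: the total
  weight contributes at most \<open>m * k\<close>, and the excess over \<open>m\<close> is largest when the weight sits on the
  first \<open>k\<close> indices.
\<close>

lemma weighted_sum_le_partial_sum:
  fixes \<mu> w :: "nat \<Rightarrow> real"
  assumes "\<And>i. i < n \<Longrightarrow> 0 \<le> \<mu> i" "\<And>i j. i \<le> j \<Longrightarrow> j < n \<Longrightarrow> \<mu> j \<le> \<mu> i"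
    and w: "\<And>i. i < n \<Longrightarrow> 0 \<le> w i" "\<And>i. i < n \<Longrightarrow> w i \<le> 1" "(\<Sum>i<n. w i) \<le> real k" and k: "k \<le> n"
  shows "(\<Sum>i<n. w i * \<mu> i) \<le> (\<Sum>i<k. \<mu> i)"
proof -
  \<comment> \<open>For \<open>k = n\<close> there are no further values to separate, and \<open>0\<close> serves as threshold.\<close>
  define m where "m = (if k < n then \<mu> k else 0)"
  have "0 \<le> m" using assms(1) by (simp add: m_def)
  have "(\<Sum>i<n. w i * \<mu> i) = (\<Sum>i<n. w i * (\<mu> i - m)) + m * (\<Sum>i<n. w i)"
    by (simp add: algebra_simps sum_subtractf sum_distrib_left)
  also have "\<dots> \<le> (\<Sum>i<n. if i < k then \<mu> i - m else 0) + m * real k"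
  proof (intro add_mono sum_mono mult_left_mono w \<open>0 \<le> m\<close>)
    fix i assume "i \<in> {..<n}"
    then have i: "i < n" by simp
    show "w i * (\<mu> i - m) \<le> (if i < k then \<mu> i - m else 0)"
    proof (cases "i < k")
      case True
      then have "0 \<le> \<mu> i - m" using assms(1,2) i by (simp add: m_def)
      then show ?thesis using True w(1,2)[OF i] by (simp add: mult_left_le_one_le)
    next
      case False
      then have "\<mu> i - m \<le> 0" using assms(2) i by (simp add: m_def)
      then show ?thesis using False w(1)[OF i] by (simp add: mult_nonneg_nonpos)
    qed
  qed
  also have "(\<Sum>i<n. if i < k then \<mu> i - m else 0) = (\<Sum>i<k. \<mu> i - m)"
    using k by (simp add: sum.inter_filter[symmetric] lessThan_def[symmetric] cong: conj_cong)
      (intro sum.cong, auto)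
  finally show ?thesis by (simp add: sum_subtractf)
qed

section \<open>Ky Fan sums\<close>

locale trace_eja = euclidean_jordan_algebra +
  assumes trace_inner: "inner y z = jtrace (\<odot>) e (y \<odot> z)"
begin

lemma spectral_decomposition_of_system:
  assumes "complete_system {..<rk} d"
  shows "spectral_decomposition (\<odot>) e (\<Sum>i<rk. a i *\<^sub>R d i) (map a [0..<rk]) (map d [0..<rk])"
  using assms by (simp add: spectral_decomposition_iff complete_system_def)

text \<open>
  The only place where the inner product is compared with the trace: a primitive idempotent has the
  eigenvalues \<open>1, 0, \<dots>, 0\<close>.
\<close>

lemma norm_primitive:
  assumes d: "complete_system {..<rk} d" and i: "i < rk"
  shows "norm (d i) = 1"
proof -
  define a where "a j = (if j = i then 1 else 0 :: real)" for j
  have "(\<Sum>j<rk. a j *\<^sub>R d j) = d i"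
    using i by (simp add: a_def if_distrib[of "\<lambda>s. s *\<^sub>R _"] cong: if_cong)
  then have "eigvals (\<odot>) e (d i) = decr (map a [0..<rk])"
    using eigvals_eq[OF spectral_decomposition_of_system[OF d, of a]] by simp
  then have "jtrace (\<odot>) e (d i) = sum_list (map a [0..<rk])"
    unfolding jtrace_def by (metis mset_decr sum_mset_sum_list)
  also have "\<dots> = (\<Sum>j<rk. a j)"
    by (simp add: sum_list_sum_nth atLeast0LessThan)
  also have "\<dots> = 1" using i by (simp add: a_def)
  finally have "inner (d i) (d i) = 1"
    using trace_inner[of "d i" "d i"] d i by (simp add: complete_system_def)
  then show ?thesis by (simp add: norm_eq_1)
qed

text \<open>
  The Ky Fan \<open>k\<close>-norm.
\<close>

definition ky_fan :: "nat \<Rightarrow> 'a \<Rightarrow> real" where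
  "ky_fan k x = (\<Sum>i<k. abs_eigvals x ! i)"

text \<open>
  For Jordan frames \<open>c\<close> and \<open>d\<close> the matrix \<open>\<langle>c i, d j\<rangle>\<close> is doubly stochastic: its entries are nonnegative,
  and its rows and columns sum to \<open>\<langle>c i, e\<rangle> = \<langle>e, d j\<rangle> = 1\<close>. It therefore spreads weights bounded by 1 with
  total at most \<open>k\<close> into weights of the same kind on the eigenvalues of \<open>x\<close>.
\<close>

lemma ky_fan_upper:
  assumes d: "complete_system {..<rk} d" and k: "k \<le> rk"
    and t: "\<And>j. j < rk \<Longrightarrow> \<bar>t j\<bar> \<le> 1" "(\<Sum>j<rk. \<bar>t j\<bar>) \<le> real k"
  shows "inner x (\<Sum>j<rk. t j *\<^sub>R d j) \<le> ky_fan k x"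
proof -
  obtain xs es where dec: "spectral_decomposition (\<odot>) e x xs es" and abs: "map abs xs = abs_eigvals x"
    using abs_sorted_decomposition .
  have es: "complete_system {..<rk} (\<lambda>i. es ! i)" and len: "length xs = rk"
    and x: "x = (\<Sum>i<rk. xs ! i *\<^sub>R es ! i)"
    using dec by (auto simp: spectral_decomposition_iff)
  have abs_nth: "\<bar>xs ! i\<bar> = abs_eigvals x ! i" if "i < rk" for i
    using that len by (simp flip: abs)
  define w where "w i = (\<Sum>j<rk. \<bar>t j\<bar> * inner (es ! i) (d j))" for i
  have ip: "0 \<le> inner (es ! i) (d j)" if "i < rk" "j < rk" for i j
    using es d that by (intro inner_idempotents_nonneg) (auto simp: complete_system_def)
  have unit: "inner c e = 1" if "complete_system {..<rk} f" "i < rk" "c = f i" for c i f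
    using idempotent_inner_unit[of c] norm_primitive[of f i] that by (simp add: complete_system_def)
  have "inner x (\<Sum>j<rk. t j *\<^sub>R d j) = (\<Sum>i<rk. \<Sum>j<rk. xs ! i * (t j * inner (es ! i) (d j)))"
    unfolding x inner_sum_left by (simp add: inner_sum_right sum_distrib_left mult.left_commute)
  also have "\<dots> \<le> (\<Sum>i<rk. \<Sum>j<rk. \<bar>xs ! i\<bar> * (\<bar>t j\<bar> * inner (es ! i) (d j)))"
  proof (intro sum_mono)
    fix i j assume "i \<in> {..<rk}" "j \<in> {..<rk}"
    then have "0 \<le> inner (es ! i) (d j)" using ip by simp
    then have "\<bar>xs ! i * (t j * inner (es ! i) (d j))\<bar> = \<bar>xs ! i\<bar> * (\<bar>t j\<bar> * inner (es ! i) (d j))"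
      by (simp add: abs_mult)
    then show "xs ! i * (t j * inner (es ! i) (d j)) \<le> \<bar>xs ! i\<bar> * (\<bar>t j\<bar> * inner (es ! i) (d j))"
      by (metis abs_ge_self)
  qed
  also have "\<dots> = (\<Sum>i<rk. w i * abs_eigvals x ! i)"
    by (intro sum.cong refl) (simp add: w_def sum_distrib_left abs_nth mult.commute)
  also have "\<dots> \<le> (\<Sum>i<k. abs_eigvals x ! i)"
  proof (rule weighted_sum_le_partial_sum)
    show "0 \<le> abs_eigvals x ! i" if "i < rk" for i
      using abs_eigvals_nonneg_decr[of x] that by (simp add: nonneg_decr_iff)
    show "abs_eigvals x ! j \<le> abs_eigvals x ! i" if "i \<le> j" "j < rk" for i j
      using abs_eigvals_nonneg_decr[of x] that by (simp add: nonneg_decr_iff)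
    show "0 \<le> w i" if "i < rk" for i
      unfolding w_def using ip that by (intro sum_nonneg) auto
    show "w i \<le> 1" if i: "i < rk" for i
    proof -
      have "w i \<le> (\<Sum>j<rk. 1 * inner (es ! i) (d j))"
        unfolding w_def using ip i t(1) by (intro sum_mono mult_right_mono) auto
      also have "\<dots> = inner (es ! i) e"
        using d by (simp add: complete_system_def flip: inner_sum_right)
      also have "\<dots> = 1" using unit[OF es i refl] .
      finally show ?thesis .
    qed
    have "(\<Sum>i<rk. w i) = (\<Sum>j<rk. \<bar>t j\<bar> * inner (\<Sum>i<rk. es ! i) (d j))"
      unfolding w_def inner_sum_left sum_distrib_left by (rule sum.swap)
    also have "\<dots> = (\<Sum>j<rk. \<bar>t j\<bar>)"
      using es unit[OF d _ refl] by (intro sum.cong) (simp_all add: complete_system_def inner_commute)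
    finally show "(\<Sum>i<rk. w i) \<le> real k" using t(2) by simp
  qed (rule k)
  finally show ?thesis by (simp add: ky_fan_def)
qed

lemma ky_fan_attained:
  assumes k: "k \<le> rk"
  obtains d t where "complete_system {..<rk} d" "\<And>j. j < rk \<Longrightarrow> \<bar>t j\<bar> \<le> 1" "(\<Sum>j<rk. \<bar>t j\<bar>) \<le> real k"
    "inner x (\<Sum>j<rk. t j *\<^sub>R d j) = ky_fan k x"
proof -
  obtain xs es where dec: "spectral_decomposition (\<odot>) e x xs es" and abs: "map abs xs = abs_eigvals x"
    using abs_sorted_decomposition .
  have es: "complete_system {..<rk} (\<lambda>i. es ! i)" and len: "length xs = rk"
    and x: "x = (\<Sum>i<rk. xs ! i *\<^sub>R es ! i)"
    using dec by (auto simp: spectral_decomposition_iff)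
  have abs_nth: "\<bar>xs ! i\<bar> = abs_eigvals x ! i" if "i < rk" for i
    using that len by (simp flip: abs)
  have restrict: "(\<Sum>j<rk. if j < k then f j else 0) = (\<Sum>j<k. f j)" for f :: "nat \<Rightarrow> real"
    using k by (intro sum.mono_neutral_cong_right) auto
  define t where "t j = (if j < k then sgn (xs ! j) else 0)" for j
  have "inner x (\<Sum>j<rk. t j *\<^sub>R es ! j) = (\<Sum>j<rk. t j * inner x (es ! j))"
    by (simp add: inner_sum_right)
  also have "\<dots> = (\<Sum>j<rk. t j * xs ! j)"
    using complete_system_inner[OF es, of _ "\<lambda>i. xs ! i"] norm_primitive[OF es]
    by (intro sum.cong) (simp_all flip: x)
  also have "\<dots> = (\<Sum>j<rk. if j < k then \<bar>xs ! j\<bar> else 0)"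
    by (intro sum.cong) (auto simp: t_def sgn_mult_self_eq abs_sgn mult.commute)
  also have "\<dots> = (\<Sum>j<k. \<bar>xs ! j\<bar>)" by (rule restrict)
  also have "\<dots> = ky_fan k x"
    unfolding ky_fan_def using k abs_nth by (intro sum.cong) auto
  finally have 1: "inner x (\<Sum>j<rk. t j *\<^sub>R es ! j) = ky_fan k x" .
  have t1: "\<bar>t j\<bar> \<le> (if j < k then 1 else 0)" for j
    by (auto simp: t_def abs_sgn_eq)
  have 2: "\<bar>t j\<bar> \<le> 1" for j
    using t1[of j] by (simp split: if_splits)
  have "(\<Sum>j<rk. \<bar>t j\<bar>) \<le> (\<Sum>j<rk. if j < k then 1 else 0)" using t1 by (rule sum_mono)
  also have "\<dots> = real k" by (simp add: restrict)
  finally show ?thesis using that[OF es, of t] 1 2 by blast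
qed

text \<open>
  Convexity of a maximum of linear functionals: a functional that attains the maximum at the sum is
  admissible for each summand.
\<close>

lemma ky_fan_sum_le:
  assumes k: "k \<le> rk" and \<alpha>: "\<And>j. j \<in> J \<Longrightarrow> 0 \<le> \<alpha> j"
  shows "ky_fan k (\<Sum>j\<in>J. \<alpha> j *\<^sub>R y j) \<le> (\<Sum>j\<in>J. \<alpha> j * ky_fan k (y j))"
proof -
  obtain d t where d: "complete_system {..<rk} d" "\<And>j. j < rk \<Longrightarrow> \<bar>t j\<bar> \<le> 1" "(\<Sum>j<rk. \<bar>t j\<bar>) \<le> real k"
    and eq: "inner (\<Sum>j\<in>J. \<alpha> j *\<^sub>R y j) (\<Sum>j<rk. t j *\<^sub>R d j) = ky_fan k (\<Sum>j\<in>J. \<alpha> j *\<^sub>R y j)"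
    using ky_fan_attained[OF k, of "\<Sum>j\<in>J. \<alpha> j *\<^sub>R y j"] by blast
  have "ky_fan k (\<Sum>j\<in>J. \<alpha> j *\<^sub>R y j) = (\<Sum>j\<in>J. \<alpha> j * inner (y j) (\<Sum>j<rk. t j *\<^sub>R d j))"
    unfolding eq[symmetric] by (simp add: inner_sum_left)
  also have "\<dots> \<le> (\<Sum>j\<in>J. \<alpha> j * ky_fan k (y j))"
    using ky_fan_upper[OF d(1) k d(2,3)] \<alpha> by (intro sum_mono mult_left_mono) auto
  finally show ?thesis .
qed

lemma norm_frame_sum_le:
  assumes d: "complete_system {..<rk} d" and "I \<subseteq> {..<rk}"
  shows "norm (\<Sum>j\<in>I. t j *\<^sub>R d j) \<le> (\<Sum>j\<in>I. \<bar>t j\<bar>)"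
  by (rule order_trans[OF norm_sum]) (use assms norm_primitive[OF d] in \<open>auto intro!: sum_mono\<close>)

lemma ky_fan_le_norm:
  assumes "k \<le> rk"
  shows "ky_fan k x \<le> real rk * norm x"
proof -
  obtain d t where d: "complete_system {..<rk} d" "(\<Sum>j<rk. \<bar>t j\<bar>) \<le> real k"
    and eq: "inner x (\<Sum>j<rk. t j *\<^sub>R d j) = ky_fan k x"
    using ky_fan_attained[OF assms, of x] by blast
  have "ky_fan k x \<le> norm x * norm (\<Sum>j<rk. t j *\<^sub>R d j)"
    unfolding eq[symmetric] by (rule norm_cauchy_schwarz)
  also have "\<dots> \<le> norm x * real rk"
    using norm_frame_sum_le[OF d(1), of "{..<rk}" t] d(2) assms by (intro mult_left_mono) auto
  finally show ?thesis by (simp add: mult.commute)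
qed

section \<open>Sign elements and the vector eta\<close>

text \<open>
  The signed sum of \<open>j\<close> members of a Jordan frame (for \<open>j\<close> at most the rank), so that its absolute
  value is an idempotent of rank \<open>j\<close>. These elements are the extremal test elements for \<open>eta_bound\<close>.
\<close>

definition sign_element :: "nat \<Rightarrow> 'a \<Rightarrow> bool" where
  "sign_element j u \<longleftrightarrow> (\<exists>d \<epsilon>. complete_system {..<rk} d \<and> (\<forall>i. \<bar>\<epsilon> i\<bar> = (1::real)) \<and>
     u = (\<Sum>i<j. \<epsilon> i *\<^sub>R d i))"

lemma abs_eigvals_sign_element:
  assumes "sign_element j u" "j \<le> rk" "i < rk"
  shows "abs_eigvals u ! i = (if i < j then 1 else 0)"
proof -
  obtain d \<epsilon> where d: "complete_system {..<rk} d" and \<epsilon>: "\<And>i. \<bar>\<epsilon> i\<bar> = (1::real)"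
    and u: "u = (\<Sum>i<j. \<epsilon> i *\<^sub>R d i)"
    using assms(1) unfolding sign_element_def by blast
  define a where "a i = (if i < j then \<epsilon> i else 0)" for i
  have "u = (\<Sum>i<rk. a i *\<^sub>R d i)"
    unfolding u using assms(2) by (intro sum.mono_neutral_cong_left) (auto simp: a_def)
  then have "abs_eigvals u = decr (map abs (map a [0..<rk]))"
    using abs_eigvals_eq[OF spectral_decomposition_of_system[OF d, of a]] by simp
  also have "\<dots> = map abs (map a [0..<rk])"
    by (rule decr_eqI) (auto simp: sorted_wrt_iff_nth_less a_def \<epsilon>)
  finally show ?thesis using assms(3) by (simp add: a_def \<epsilon>)
qed

text \<open>
  Abel summation of the spectral decomposition, ordered by absolute values. The value beyond the last
  index is taken to be 0, so that the last coefficient is the least eigenvalue of \<open>|x|\<close>.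
\<close>

lemma layer_decomposition:
  obtains u where "\<And>j. sign_element j (u j)"
    "x = (\<Sum>j<rk. (abs_eigvals x ! j - (if Suc j < rk then abs_eigvals x ! Suc j else 0)) *\<^sub>R u (Suc j))"
proof -
  obtain xs es where dec: "spectral_decomposition (\<odot>) e x xs es" and abs: "map abs xs = abs_eigvals x"
    using abs_sorted_decomposition .
  have es: "complete_system {..<rk} (\<lambda>i. es ! i)" and len: "length xs = rk"
    and x: "x = (\<Sum>i<rk. xs ! i *\<^sub>R es ! i)"
    using dec by (auto simp: spectral_decomposition_iff)
  define \<mu> where "\<mu> i = (if i < rk then abs_eigvals x ! i else 0)" for i
  define \<epsilon> where "\<epsilon> i = (if xs ! i \<ge> 0 then 1 else -1 :: real)" for i
  define u where "u j = (\<Sum>i<j. \<epsilon> i *\<^sub>R es ! i)" for j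
  have "xs ! i = \<mu> i * \<epsilon> i" if "i < rk" for i
    using that len by (simp add: \<mu>_def \<epsilon>_def flip: abs)
  then have "x = (\<Sum>i<rk. \<mu> i *\<^sub>R (\<epsilon> i *\<^sub>R es ! i))"
    unfolding x by (intro sum.cong) auto
  also have "\<dots> = (\<Sum>j<rk. (\<mu> j - \<mu> (Suc j)) *\<^sub>R u (Suc j))"
    unfolding u_def by (subst abel_summation) (simp add: \<mu>_def)
  also have "\<dots> = (\<Sum>j<rk. (abs_eigvals x ! j - (if Suc j < rk then abs_eigvals x ! Suc j else 0)) *\<^sub>R u (Suc j))"
    by (intro sum.cong) (auto simp: \<mu>_def)
  finally have "x = \<dots>" .
  moreover have "sign_element j (u j)" for j
    unfolding sign_element_def u_def using es by (intro exI[of _ "\<lambda>i. es ! i"] exI[of _ \<epsilon>]) (auto simp: \<epsilon>_def)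
  ultimately show ?thesis using that[of u] by simp
qed

lemma eta_bound_ky_fan:
  assumes q: "q \<in> nonneg_decr rk"
  shows "eta_bound (\<odot>) e T q \<longleftrightarrow>
    (\<forall>x. \<forall>k\<in>{1..rk}. ky_fan k (T x) \<le> (\<Sum>i<k. q ! i * abs_eigvals x ! i))"
proof -
  have "abs_eigvals (T x) \<prec>\<^sub>w cw_prod q (abs_eigvals x) \<longleftrightarrow>
      (\<forall>k\<in>{1..rk}. ky_fan k (T x) \<le> (\<Sum>i<k. q ! i * abs_eigvals x ! i))" for x
  proof -
    have len: "length q = rk" "length (abs_eigvals x) = rk"
      using q abs_eigvals_nonneg_decr[of x] by (auto simp: nonneg_decr_iff)
    have "(\<Sum>i<k. cw_prod q (abs_eigvals x) ! i) = (\<Sum>i<k. q ! i * abs_eigvals x ! i)" if "k \<in> {1..rk}" for k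
      using that len by (intro sum.cong) (auto simp: cw_prod_nth)
    then show ?thesis
      unfolding weakly_majorized_iff[OF abs_eigvals_nonneg_decr cw_prod_nonneg_decr[OF q abs_eigvals_nonneg_decr]]
      by (simp add: ky_fan_def)
  qed
  then show ?thesis using q by (simp add: eta_bound_def)
qed

text \<open>
  Necessity is the case of a sign element, whose absolute eigenvalues are \<open>j\<close> ones followed by zeros.
  Sufficiency follows from the layer decomposition by convexity of the Ky Fan sums; a second Abel
  summation turns the resulting bound back into \<open>q * \<lambda>(|x|)\<close>.
\<close>

lemma eta_bound_iff:
  assumes lin: "linear T" and q: "q \<in> nonneg_decr rk"
  shows "eta_bound (\<odot>) e T q \<longleftrightarrow>
    (\<forall>k\<in>{1..rk}. \<forall>j\<in>{1..rk}. \<forall>u. sign_element j u \<longrightarrow> ky_fan k (T u) \<le> (\<Sum>i<min k j. q ! i))"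
    (is "_ \<longleftrightarrow> ?R")
proof
  assume eb: "eta_bound (\<odot>) e T q"
  show ?R
  proof (intro ballI allI impI)
    fix k j u assume k: "k \<in> {1..rk}" and j: "j \<in> {1..rk}" and u: "sign_element j u"
    have "ky_fan k (T u) \<le> (\<Sum>i<k. q ! i * abs_eigvals u ! i)"
      using eb k unfolding eta_bound_ky_fan[OF q] by blast
    also have "\<dots> = (\<Sum>i<min k j. q ! i)"
      using k j abs_eigvals_sign_element[OF u] by (intro sum.mono_neutral_cong_right) auto
    finally show "ky_fan k (T u) \<le> (\<Sum>i<min k j. q ! i)" .
  qed
next
  assume R: ?R
  show "eta_bound (\<odot>) e T q"
    unfolding eta_bound_ky_fan[OF q]
  proof (intro allI ballI)
    fix x k assume k: "k \<in> {1..rk}"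
    define \<mu> where "\<mu> i = (if i < rk then abs_eigvals x ! i else 0)" for i
    obtain u where u: "\<And>j. sign_element j (u j)"
      and x: "x = (\<Sum>j<rk. (abs_eigvals x ! j - (if Suc j < rk then abs_eigvals x ! Suc j else 0)) *\<^sub>R u (Suc j))"
      using layer_decomposition[of x] by blast
    have x': "x = (\<Sum>j<rk. (\<mu> j - \<mu> (Suc j)) *\<^sub>R u (Suc j))"
      by (subst x) (intro sum.cong, auto simp: \<mu>_def)
    have pos: "0 \<le> \<mu> j - \<mu> (Suc j)" if "j < rk" for j
      using abs_eigvals_nonneg_decr[of x] that by (auto simp: \<mu>_def nonneg_decr_iff)
    have "ky_fan k (T x) = ky_fan k (\<Sum>j<rk. (\<mu> j - \<mu> (Suc j)) *\<^sub>R T (u (Suc j)))"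
      by (subst x') (simp add: linear_sum[OF lin] linear_cmul[OF lin])
    also have "\<dots> \<le> (\<Sum>j<rk. (\<mu> j - \<mu> (Suc j)) * ky_fan k (T (u (Suc j))))"
      using k pos by (intro ky_fan_sum_le) auto
    also have "\<dots> \<le> (\<Sum>j<rk. (\<mu> j - \<mu> (Suc j)) * (\<Sum>i<min k (Suc j). q ! i))"
      using R k u pos by (intro sum_mono mult_left_mono) auto
    also have "\<dots> = (\<Sum>j<rk. (\<mu> j - \<mu> (Suc j)) *\<^sub>R (\<Sum>i<Suc j. if i < k then q ! i else 0))"
    proof (intro sum.cong refl)
      fix j
      have "(\<Sum>i<min k (Suc j). q ! i) = (\<Sum>i<Suc j. if i < k then q ! i else 0)"
        by (intro sum.mono_neutral_cong_left) auto
      then show "(\<mu> j - \<mu> (Suc j)) * (\<Sum>i<min k (Suc j). q ! i) =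
          (\<mu> j - \<mu> (Suc j)) *\<^sub>R (\<Sum>i<Suc j. if i < k then q ! i else 0)" by simp
    qed
    also have "\<dots> = (\<Sum>i<rk. \<mu> i *\<^sub>R (if i < k then q ! i else 0))"
      using abel_summation[of \<mu> "\<lambda>i. if i < k then q ! i else 0" rk] by (simp add: \<mu>_def)
    also have "\<dots> = (\<Sum>i<k. q ! i * abs_eigvals x ! i)"
      using k by (intro sum.mono_neutral_cong_right) (auto simp: \<mu>_def)
    finally show "ky_fan k (T x) \<le> (\<Sum>i<k. q ! i * abs_eigvals x ! i)" .
  qed
qed

text \<open>
  A constant vector works: sign elements are bounded, so the Ky Fan sums of their images are bounded by
  some \<open>C\<close>, and every nonempty partial sum of the constant vector is at least \<open>C\<close>.
\<close>

lemma eta_bound_nonempty: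
  assumes lin: "linear T"
  shows "\<exists>q. eta_bound (\<odot>) e T q"
proof -
  obtain B where B: "0 < B" "\<And>x. norm (T x) \<le> B * norm x"
    using linear_bounded_pos[OF lin] by blast
  define C where "C = real rk * (B * real rk)"
  have "0 \<le> C" using B(1) by (simp add: C_def)
  have q: "replicate rk C \<in> nonneg_decr rk" using \<open>0 \<le> C\<close> by (simp add: nonneg_decr_iff)
  have "eta_bound (\<odot>) e T (replicate rk C)"
    unfolding eta_bound_iff[OF lin q]
  proof (intro ballI allI impI)
    fix k j u assume k: "k \<in> {1..rk}" and j: "j \<in> {1..rk}" and u: "sign_element j u"
    obtain d \<epsilon> where d: "complete_system {..<rk} d" and \<epsilon>: "\<And>i. \<bar>\<epsilon> i\<bar> = (1::real)"
      and ueq: "u = (\<Sum>i<j. \<epsilon> i *\<^sub>R d i)"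
      using u unfolding sign_element_def by blast
    have "norm u \<le> real rk"
      using norm_frame_sum_le[OF d, of "{..<j}" \<epsilon>] j \<epsilon> by (simp add: ueq)
    then have "norm (T u) \<le> B * real rk"
      using B(2)[of u] B(1) by (meson mult_left_mono order_trans less_imp_le)
    then have "ky_fan k (T u) \<le> C"
      using ky_fan_le_norm[of k "T u"] k unfolding C_def
      by (meson atLeastAtMost_iff mult_left_mono of_nat_0_le_iff order_trans)
    also have "C \<le> (\<Sum>i<min k j. C)"
      using k j \<open>0 \<le> C\<close> mult_right_mono[of 1 "real (min k j)" C] by simp
    also have "\<dots> = (\<Sum>i<min k j. replicate rk C ! i)"
      using k by (intro sum.cong) auto
    finally show "ky_fan k (T u) \<le> (\<Sum>i<min k j. replicate rk C ! i)" .
  qed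
  then show ?thesis by blast
qed

text \<open>
  The least vector has as partial sums the infima \<open>Q\<close> of the partial sums of all admissible vectors. It
  is nonnegative and decreasing because \<open>Q\<close> inherits monotonicity and concavity, and it is admissible
  because each condition of \<open>eta_bound_iff\<close> involves a single partial sum.
\<close>

theorem eta_exists:
  assumes lin: "linear T"
  shows "\<exists>v. eta_bound (\<odot>) e T v \<and> (\<forall>q. eta_bound (\<odot>) e T q \<longrightarrow> v \<prec>\<^sub>w q)"
proof -
  define E where "E = {q. eta_bound (\<odot>) e T q}"
  have E: "E \<noteq> {}" using eta_bound_nonempty[OF lin] by (auto simp: E_def)
  define P where "P q l = (\<Sum>i<l. q ! i)" for q :: "real list" and l
  have Eq: "q \<in> nonneg_decr rk" if "q \<in> E" for q
    using that by (simp add: E_def eta_bound_def)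
  have P0: "0 \<le> P q l" if "q \<in> E" "l \<le> rk" for q l
    unfolding P_def using Eq[OF that(1)] that(2) by (intro sum_nonneg) (auto simp: nonneg_decr_iff)
  define Q where "Q l = (INF q\<in>E. P q l)" for l
  have Qle: "Q l \<le> P q l" if "q \<in> E" "l \<le> rk" for q l
    unfolding Q_def by (rule cINF_lower[OF bdd_belowI2[of _ 0]]) (use that P0 in auto)
  have Qge: "m \<le> Q l" if "\<And>q. q \<in> E \<Longrightarrow> m \<le> P q l" for m l
    unfolding Q_def by (rule cINF_greatest) (use E that in auto)
  define v where "v = map (\<lambda>i. Q (Suc i) - Q i) [0..<rk]"
  have Q0: "Q 0 = 0" using E by (simp add: Q_def P_def)
  have Pv: "P v l = Q l" if "l \<le> rk" for l
  proof -
    have "P v l = (\<Sum>i<l. Q (Suc i) - Q i)"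
      unfolding P_def v_def using that by (intro sum.cong) auto
    then show ?thesis using sum_lessThan_telescope[of Q l] Q0 by simp
  qed
  have incr: "Q i \<le> Q (Suc i)" if "i < rk" for i
  proof (rule Qge)
    fix q assume q: "q \<in> E"
    have "Q i \<le> P q i" using Qle q that by simp
    also have "\<dots> \<le> P q (Suc i)" using Eq[OF q] that by (simp add: P_def nonneg_decr_iff)
    finally show "Q i \<le> P q (Suc i)" .
  qed
  have concave: "Q (Suc (Suc i)) - Q (Suc i) \<le> Q (Suc i) - Q i" if "Suc i < rk" for i
  proof -
    have "(Q i + Q (Suc (Suc i))) / 2 \<le> Q (Suc i)"
    proof (rule Qge)
      fix q assume q: "q \<in> E"
      have "Q i \<le> P q i" "Q (Suc (Suc i)) \<le> P q (Suc (Suc i))" using Qle q that by auto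
      moreover have "q ! Suc i \<le> q ! i" using Eq[OF q] that by (simp add: nonneg_decr_iff)
      ultimately show "(Q i + Q (Suc (Suc i))) / 2 \<le> P q (Suc i)" by (simp add: P_def)
    qed
    then show ?thesis by simp
  qed
  have decr: "Q (Suc j) - Q j \<le> Q (Suc i) - Q i" if "i \<le> j" "j < rk" for i j
    using that
  proof (induction j rule: dec_induct)
    case (step j)
    then show ?case using concave[of j] by simp
  qed simp
  have vN: "v \<in> nonneg_decr rk"
    unfolding nonneg_decr_iff using incr decr by (auto simp: v_def)
  have "eta_bound (\<odot>) e T v"
    unfolding eta_bound_iff[OF lin vN]
  proof (intro ballI allI impI)
    fix k j u assume k: "k \<in> {1..rk}" and j: "j \<in> {1..rk}" and u: "sign_element j u"
    have "ky_fan k (T u) \<le> Q (min k j)"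
    proof (rule Qge)
      fix q assume q: "q \<in> E"
      then have "eta_bound (\<odot>) e T q" by (simp add: E_def)
      then show "ky_fan k (T u) \<le> P q (min k j)"
        unfolding eta_bound_iff[OF lin Eq[OF q]] P_def using k j u by blast
    qed
    then show "ky_fan k (T u) \<le> (\<Sum>i<min k j. v ! i)"
      using Pv[of "min k j"] k by (simp add: P_def min.coboundedI1)
  qed
  moreover have "v \<prec>\<^sub>w q" if "eta_bound (\<odot>) e T q" for q
  proof -
    have q: "q \<in> E" using that by (simp add: E_def)
    show ?thesis
      unfolding weakly_majorized_iff[OF vN Eq[OF q]]
      using Qle[OF q] Pv by (simp add: P_def)
  qed
  ultimately show ?thesis by blast
qed

theorem eta_bound_eta:
  assumes lin: "linear T"
  shows "eta_bound (\<odot>) e T (eta (\<odot>) e T)"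
proof -
  let ?min = "\<lambda>v. eta_bound (\<odot>) e T v \<and> (\<forall>q. eta_bound (\<odot>) e T q \<longrightarrow> v \<prec>\<^sub>w q)"
  obtain v where v: "?min v" using eta_exists[OF lin] by blast
  have "?min (THE v. ?min v)"
  proof (rule theI[of ?min, OF v])
    fix w assume w: "?min w"
    show "w = v"
      using v w by (intro weakly_majorized_antisym[of w rk v]) (auto simp: eta_bound_def)
  qed
  then show ?thesis by (simp add: eta_def)
qed

end

section \<open>Norms of vectors\<close>

lemma vec_norm_real: "vec_norm (ereal r) u = (\<Sum>i<length u. \<bar>u ! i\<bar> powr r) powr (1 / r)"
  by (simp add: vec_norm_def)

lemma vec_norm_infinity: "vec_norm \<infinity> u = Max ((\<lambda>t. \<bar>t\<bar>) ` set u)"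
  by (simp add: vec_norm_def)

lemma ge_one_cases:
  assumes "1 \<le> (r::ereal)"
  obtains "r = \<infinity>" | r' where "r = ereal r'" "1 \<le> r'"
  using assms by (cases r) auto

lemma vec_norm_cong_abs:
  assumes "mset (map abs u) = mset (map abs v)"
  shows "vec_norm p u = vec_norm p v"
proof -
  have "(\<Sum>i<length w. \<bar>w ! i\<bar> powr r) = sum_mset (image_mset (\<lambda>t. t powr r) (mset (map abs w)))"
    for w :: "real list" and r
  proof -
    have "(\<Sum>i<length w. \<bar>w ! i\<bar> powr r) = sum_list (map (\<lambda>t. \<bar>t\<bar> powr r) w)"
      by (simp add: sum_list_sum_nth atLeast0LessThan)
    also have "\<dots> = sum_mset (mset (map (\<lambda>t. \<bar>t\<bar> powr r) w))" by (simp only: sum_mset_sum_list)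
    also have "mset (map (\<lambda>t. \<bar>t\<bar> powr r) w) = image_mset (\<lambda>t. t powr r) (mset (map abs w))"
      by (simp add: multiset.map_comp comp_def)
    finally show ?thesis .
  qed
  moreover have "(\<lambda>t. \<bar>t\<bar>) ` set u = (\<lambda>t. \<bar>t\<bar>) ` set v"
    using arg_cong[OF assms, of set_mset] by simp
  ultimately show ?thesis using assms by (simp add: vec_norm_def)
qed

lemma young_weighted:
  fixes a b :: real
  assumes "0 \<le> a" "0 \<le> b" "0 \<le> \<alpha>" "0 \<le> \<beta>" "\<alpha> + \<beta> = 1"
  shows "a powr \<alpha> * b powr \<beta> \<le> \<alpha> * a + \<beta> * b"
proof (cases "a = 0 \<or> b = 0")
  case True
  then show ?thesis using assms by auto
next
  case False
  then show ?thesis using Youngs_inequality_0[of \<alpha> \<beta> a b] assms by auto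
qed

text \<open>
  This is the weighted Young inequality for \<open>b\<^sup>p\<close> and \<open>a\<^sup>p\<close> with weights \<open>1/p\<close> and \<open>1 - 1/p\<close>, which unlike
  differentiation also covers \<open>b = 0\<close>.
\<close>

lemma powr_above_tangent:
  fixes a b :: real
  assumes "0 \<le> a" "0 \<le> b" "1 \<le> p"
  shows "a powr p + p * (a powr (p - 1) * (b - a)) \<le> b powr p"
proof (cases "a = 0")
  case False
  then have "0 < a" using assms by simp
  have "(b powr p) powr (1 / p) * (a powr p) powr (1 - 1 / p) \<le> (1 / p) * (b powr p) + (1 - 1 / p) * (a powr p)"
    using assms by (intro young_weighted) auto
  moreover have "(b powr p) powr (1 / p) = b"
    using assms by (simp add: powr_powr)
  moreover have "(a powr p) powr (1 - 1 / p) = a powr (p - 1)"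
    using assms by (simp add: powr_powr right_diff_distrib)
  ultimately have "b * a powr (p - 1) \<le> (1 / p) * (b powr p) + (1 - 1 / p) * (a powr p)" by simp
  then have "p * (b * a powr (p - 1)) \<le> p * ((1 / p) * (b powr p) + (1 - 1 / p) * (a powr p))"
    using assms by (intro mult_left_mono) auto
  also have "\<dots> = b powr p + (p - 1) * a powr p" using assms by (simp add: field_simps)
  finally have "p * (b * a powr (p - 1)) \<le> b powr p + (p - 1) * a powr p" .
  moreover have "a powr p = a powr (p - 1) * a"
    using \<open>0 < a\<close> powr_add[of a "p - 1" 1] by simp
  ultimately show ?thesis by (simp add: algebra_simps)
qed simp

text \<open>
  For finite \<open>p\<close>, the tangents of \<open>t \<mapsto> t\<^sup>p\<close> at the entries of \<open>a\<close> have decreasing nonnegative slopes, so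
  Abel summation bounds the sum of the increments \<open>b\<^sup>p - a\<^sup>p\<close> below by a nonnegative combination of the
  differences of partial sums.
\<close>

lemma vec_norm_weakly_majorized:
  assumes a: "a \<in> nonneg_decr n" and b: "b \<in> nonneg_decr n" and n: "0 < n"
    and maj: "a \<prec>\<^sub>w b" and p: "1 \<le> p"
  shows "vec_norm p a \<le> vec_norm p b"
proof -
  have len: "length a = n" "length b = n" using a b by (auto simp: nonneg_decr_iff)
  have nn: "0 \<le> a ! i" "0 \<le> b ! i" if "i < n" for i using a b that by (auto simp: nonneg_decr_iff)
  have part: "(\<Sum>i<k. a ! i) \<le> (\<Sum>i<k. b ! i)" if "k \<le> n" for k
    using maj that unfolding weakly_majorized_iff[OF a b] by (cases "k = 0") auto
  show ?thesis
    using p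
  proof (cases rule: ge_one_cases)
    case 1
    have "\<bar>t\<bar> \<le> Max ((\<lambda>t. \<bar>t\<bar>) ` set b)" if t: "t \<in> set a" for t
    proof -
      obtain i where i: "i < n" "t = a ! i" using t len by (auto simp: in_set_conv_nth)
      have "\<bar>t\<bar> \<le> a ! 0" using a i nn by (simp add: nonneg_decr_iff)
      also have "\<dots> \<le> b ! 0" using part[of 1] n by simp
      also have "\<dots> \<le> \<bar>b ! 0\<bar>" by simp
      also have "\<dots> \<le> Max ((\<lambda>t. \<bar>t\<bar>) ` set b)" using n len by (intro Max_ge) auto
      finally show ?thesis .
    qed
    moreover have "set a \<noteq> {}" using n len by auto
    ultimately show ?thesis unfolding 1 vec_norm_infinity by (intro Max.boundedI) auto
  next
    case (2 q)
    define w where "w i = (if i < n then (a ! i) powr (q - 1) else 0)" for i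
    have w: "0 \<le> w i - w (Suc i)" if "i < n" for i
      using a that nn 2 by (auto simp: w_def nonneg_decr_iff intro!: powr_mono2)
    have "0 \<le> (\<Sum>j<n. (w j - w (Suc j)) *\<^sub>R (\<Sum>i<Suc j. b ! i - a ! i))"
      using w part unfolding sum_subtractf real_scaleR_def
      by (intro sum_nonneg mult_nonneg_nonneg) (simp_all del: sum.lessThan_Suc)
    also have "\<dots> = (\<Sum>i<n. w i *\<^sub>R (b ! i - a ! i))"
      using abel_summation[of w "\<lambda>i. b ! i - a ! i" n] by (simp add: w_def)
    finally have "0 \<le> q * (\<Sum>i<n. w i * (b ! i - a ! i))"
      using 2 by simp
    also have "\<dots> = (\<Sum>i<n. q * ((a ! i) powr (q - 1) * (b ! i - a ! i)))"
      by (simp add: w_def sum_distrib_left)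
    also have "\<dots> \<le> (\<Sum>i<n. (b ! i) powr q - (a ! i) powr q)"
      using powr_above_tangent[of "a ! i" "b ! i" q for i] nn 2
      by (intro sum_mono) (simp add: algebra_simps)
    finally have "(\<Sum>i<n. (a ! i) powr q) \<le> (\<Sum>i<n. (b ! i) powr q)"
      by (simp add: sum_subtractf)
    then have "(\<Sum>i<n. \<bar>a ! i\<bar> powr q) \<le> (\<Sum>i<n. \<bar>b ! i\<bar> powr q)"
      using nn by simp
    then show ?thesis
      unfolding 2 vec_norm_real len using 2 by (intro powr_mono2) (auto intro: sum_nonneg)
  qed
qed

text \<open>
  After both sums are normalized to 1, the weighted Young inequality applies to each term.
\<close>

lemma holder_sum:
  fixes X Y :: "'i \<Rightarrow> real"
  assumes "finite I" "\<And>i. i \<in> I \<Longrightarrow> 0 \<le> X i" "\<And>i. i \<in> I \<Longrightarrow> 0 \<le> Y i"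
    and "0 \<le> \<alpha>" "0 \<le> \<beta>" "\<alpha> + \<beta> = 1"
  shows "(\<Sum>i\<in>I. X i powr \<alpha> * Y i powr \<beta>) \<le> (\<Sum>i\<in>I. X i) powr \<alpha> * (\<Sum>i\<in>I. Y i) powr \<beta>"
proof -
  define A B where "A = (\<Sum>i\<in>I. X i)" and "B = (\<Sum>i\<in>I. Y i)"
  have nn: "0 \<le> A" "0 \<le> B" unfolding A_def B_def using assms by (auto intro: sum_nonneg)
  show ?thesis
  proof (cases "A = 0 \<or> B = 0")
    case True
    then have "(\<forall>i\<in>I. X i = 0) \<or> (\<forall>i\<in>I. Y i = 0)"
      using assms(1-3) sum_nonneg_eq_0_iff[of I X] sum_nonneg_eq_0_iff[of I Y] by (auto simp: A_def B_def)
    then have "(\<Sum>i\<in>I. X i powr \<alpha> * Y i powr \<beta>) = 0" by (intro sum.neutral) auto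
    then show ?thesis by simp
  next
    case False
    then have pos: "0 < A" "0 < B" using nn by auto
    have "(\<Sum>i\<in>I. X i powr \<alpha> * Y i powr \<beta>) \<le>
        (\<Sum>i\<in>I. A powr \<alpha> * B powr \<beta> * (\<alpha> * (X i / A) + \<beta> * (Y i / B)))"
    proof (intro sum_mono)
      fix i assume i: "i \<in> I"
      have "X i powr \<alpha> * Y i powr \<beta> = (A * (X i / A)) powr \<alpha> * (B * (Y i / B)) powr \<beta>"
        using pos by simp
      also have "\<dots> = A powr \<alpha> * B powr \<beta> * ((X i / A) powr \<alpha> * (Y i / B) powr \<beta>)"
        using pos assms(2,3)[OF i] by (subst (1 2) powr_mult) (simp_all add: mult_ac)
      also have "\<dots> \<le> A powr \<alpha> * B powr \<beta> * (\<alpha> * (X i / A) + \<beta> * (Y i / B))"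
        using pos assms i by (intro mult_left_mono young_weighted) auto
      finally show "X i powr \<alpha> * Y i powr \<beta> \<le> A powr \<alpha> * B powr \<beta> * (\<alpha> * (X i / A) + \<beta> * (Y i / B))" .
    qed
    also have "\<dots> = A powr \<alpha> * B powr \<beta> * (\<alpha> * (A / A) + \<beta> * (B / B))"
      unfolding sum_distrib_left[symmetric] sum.distrib A_def B_def sum_divide_distrib ..
    also have "\<dots> = A powr \<alpha> * B powr \<beta>" using pos assms(6) by simp
    finally show ?thesis by (simp add: A_def B_def)
  qed
qed

lemma cw_prod_commute: "cw_prod u v = cw_prod v u"
  by (rule nth_equalityI) (auto simp: cw_prod_nth mult.commute)

lemma vec_norm_cw_prod_infinity:
  assumes len: "length u = length v" and ne: "u \<noteq> []" and p: "1 \<le> p"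
  shows "vec_norm p (cw_prod u v) \<le> vec_norm \<infinity> u * vec_norm p v"
proof -
  define M where "M = vec_norm \<infinity> u"
  have M: "\<bar>u ! i\<bar> \<le> M" if "i < length u" for i
    unfolding M_def vec_norm_infinity using that by (intro Max_ge) auto
  have "0 \<le> M" using M[of 0] ne by (metis abs_ge_zero length_greater_0_conv order_trans)
  show ?thesis
    using p
  proof (cases rule: ge_one_cases)
    case 1
    have "\<bar>t\<bar> \<le> M * vec_norm \<infinity> v" if t: "t \<in> set (cw_prod u v)" for t
    proof -
      obtain i where i: "i < length u" "t = u ! i * v ! i"
        using t len by (auto simp: in_set_conv_nth cw_prod_nth)
      have "\<bar>v ! i\<bar> \<le> vec_norm \<infinity> v"
        unfolding vec_norm_infinity using i len by (intro Max_ge) auto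
      then show ?thesis
        unfolding i(2) abs_mult using M[OF i(1)] \<open>0 \<le> M\<close> by (intro mult_mono) auto
    qed
    moreover have "cw_prod u v \<noteq> []" using ne len by (cases u; cases v) (auto simp: cw_prod_def)
    then have "set (cw_prod u v) \<noteq> {}" by simp
    ultimately show ?thesis
      unfolding 1 vec_norm_infinity[of "cw_prod u v"] M_def[symmetric] by (intro Max.boundedI) auto
  next
    case (2 q)
    have "(\<Sum>i<length v. \<bar>cw_prod u v ! i\<bar> powr q) \<le> (\<Sum>i<length v. M powr q * \<bar>v ! i\<bar> powr q)"
    proof (intro sum_mono)
      fix i assume "i \<in> {..<length v}"
      then have i: "i < length u" "i < length v" using len by auto
      have "\<bar>cw_prod u v ! i\<bar> powr q \<le> (M * \<bar>v ! i\<bar>) powr q"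
        using i M[OF i(1)] 2 by (intro powr_mono2) (auto simp: cw_prod_nth abs_mult intro: mult_right_mono)
      then show "\<bar>cw_prod u v ! i\<bar> powr q \<le> M powr q * \<bar>v ! i\<bar> powr q"
        using \<open>0 \<le> M\<close> by (simp add: powr_mult)
    qed
    also have "\<dots> = M powr q * (\<Sum>i<length v. \<bar>v ! i\<bar> powr q)" by (simp add: sum_distrib_left)
    finally have "(\<Sum>i<length v. \<bar>cw_prod u v ! i\<bar> powr q) powr (1 / q) \<le>
        (M powr q * (\<Sum>i<length v. \<bar>v ! i\<bar> powr q)) powr (1 / q)"
      using 2 by (intro powr_mono2) (auto intro: sum_nonneg)
    also have "\<dots> = M * (\<Sum>i<length v. \<bar>v ! i\<bar> powr q) powr (1 / q)"
      using 2 \<open>0 \<le> M\<close> by (subst powr_mult) (auto simp: powr_powr intro: sum_nonneg)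
    finally show ?thesis
      unfolding 2 vec_norm_real M_def[symmetric] using len by simp
  qed
qed

lemma holder_vec_norm_real:
  assumes len: "length u = length v" and pos: "1 \<le> p" "1 \<le> r" "1 \<le> s" and eq: "1 / p = 1 / r + 1 / s"
  shows "vec_norm (ereal p) (cw_prod u v) \<le> vec_norm (ereal r) u * vec_norm (ereal s) v"
proof -
  define U V where "U = (\<Sum>i<length v. \<bar>u ! i\<bar> powr r)" and "V = (\<Sum>i<length v. \<bar>v ! i\<bar> powr s)"
  have nn: "0 \<le> U" "0 \<le> V" unfolding U_def V_def by (auto intro: sum_nonneg)
  have "p * (1 / p) = p * (1 / r + 1 / s)" using eq by simp
  then have sum1: "p / r + p / s = 1" using pos by (simp add: distrib_left)
  have "(\<Sum>i<length v. \<bar>cw_prod u v ! i\<bar> powr p) =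
      (\<Sum>i<length v. (\<bar>u ! i\<bar> powr r) powr (p / r) * (\<bar>v ! i\<bar> powr s) powr (p / s))"
    using len pos by (intro sum.cong) (auto simp: cw_prod_nth abs_mult powr_mult powr_powr)
  also have "\<dots> \<le> U powr (p / r) * V powr (p / s)"
    unfolding U_def V_def using pos sum1 by (intro holder_sum) auto
  finally have "(\<Sum>i<length v. \<bar>cw_prod u v ! i\<bar> powr p) powr (1 / p) \<le> (U powr (p / r) * V powr (p / s)) powr (1 / p)"
    using pos by (intro powr_mono2) (auto intro: sum_nonneg)
  also have "\<dots> = U powr (1 / r) * V powr (1 / s)"
    using pos by (subst powr_mult) (auto simp: powr_powr)
  finally show ?thesis
    unfolding vec_norm_real U_def V_def using len by simp
qed

text \<open>
  An infinite exponent among \<open>r\<close> and \<open>s\<close> forces \<open>p\<close> to equal the other one, and two finite exponents force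
  \<open>p\<close> to be finite.
\<close>

lemma holder_vec_norm:
  assumes len: "length u = length v" and ne: "u \<noteq> []"
    and exps: "1 \<le> p" "1 \<le> r" "1 \<le> s" "1 / p = 1 / r + 1 / s"
  shows "vec_norm p (cw_prod u v) \<le> vec_norm r u * vec_norm s v"
proof -
  have inv: "1 / ereal t = ereal (1 / t)" if "1 \<le> t" for t
    using that by (simp add: one_ereal_def)
  have inv_eq: "q = q'" if "1 \<le> q" "1 \<le> q'" "1 / q = 1 / q'" for q q' :: ereal
    using that(1)
  proof (cases rule: ge_one_cases)
    case 1
    show ?thesis using that(2)
      by (cases rule: ge_one_cases) (use that(3) 1 inv in auto)
  next
    case (2 t)
    show ?thesis using that(2)
      by (cases rule: ge_one_cases) (use that(3) 2 inv in auto)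
  qed
  show ?thesis
    using exps(2)
  proof (cases rule: ge_one_cases)
    case 1
    then have "p = s" using exps inv_eq[of p s] by simp
    then show ?thesis using vec_norm_cw_prod_infinity[OF len ne exps(1)] 1 by simp
  next
    case r: (2 r')
    show ?thesis
      using exps(3)
    proof (cases rule: ge_one_cases)
      case 1
      then have "p = r" using exps inv_eq[of p r] by simp
      moreover have "v \<noteq> []" using len ne by auto
      ultimately show ?thesis
        using vec_norm_cw_prod_infinity[of v u p] len exps(1) 1 by (simp add: cw_prod_commute[of u v] mult.commute)
    next
      case s: (2 s')
      have inv_p: "1 / p = ereal (1 / r' + 1 / s')" using exps(4) r s inv by simp
      show ?thesis
        using exps(1)
      proof (cases rule: ge_one_cases)
        case 1
        have "0 < 1 / r' + 1 / s'" using r s by (simp add: add_pos_pos)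
        then show ?thesis using inv_p 1 by simp
      next
        case p: (2 p')
        have "1 / p' = 1 / r' + 1 / s'" using inv_p p inv by simp
        then show ?thesis using holder_vec_norm_real[OF len] p r s by simp
      qed
    qed
  qed
qed

section \<open>The norm inequality\<close>

context euclidean_jordan_algebra
begin

lemma spectral_norm_abs: "spectral_norm (\<odot>) e p x = vec_norm p (abs_eigvals x)"
proof -
  have "mset (map abs (abs_eigvals x)) = image_mset abs (image_mset abs (mset (eigvals (\<odot>) e x)))"
    using mset_abs_eigvals[of x] by simp
  then show ?thesis
    unfolding spectral_norm_def by (intro vec_norm_cong_abs) (simp add: multiset.map_comp comp_def)
qed

end

theorem mainTheorem4:
  fixes jp :: "'a::euclidean_space \<Rightarrow> 'a \<Rightarrow> 'a"
    and e :: 'a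
    and T :: "'a \<Rightarrow> 'a"
    and x :: 'a
    and p r s :: ereal
  assumes eja: "euclidean_jordan_algebra jp e"
    and trace_inner: "\<And>y z. inner y z = jtrace jp e (jp y z)"
    and exponents: "1 \<le> p" "1 \<le> r" "1 \<le> s" "1 / p = 1 / r + 1 / s"
    and lin: "linear T"
  shows "spectral_norm jp e p (T x) \<le> vec_norm r (eta jp e T) * spectral_norm jp e s x"
proof -
  interpret trace_eja jp e
    using eja trace_inner by (simp add: trace_eja_def trace_eja_axioms_def)
  let ?\<eta> = "eta jp e T"
  have bound: "eta_bound jp e T ?\<eta>" using lin by (rule eta_bound_eta)
  then have \<eta>: "?\<eta> \<in> nonneg_decr rk"
    and maj: "abs_eigvals (T x) \<prec>\<^sub>w cw_prod ?\<eta> (abs_eigvals x)"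
    by (auto simp: eta_bound_def)
  have len: "length ?\<eta> = rk" "length (abs_eigvals x) = rk"
    using \<eta> abs_eigvals_nonneg_decr[of x] by (auto simp: nonneg_decr_iff)
  have "spectral_norm jp e p (T x) = vec_norm p (abs_eigvals (T x))"
    by (rule spectral_norm_abs)
  also have "\<dots> \<le> vec_norm p (cw_prod ?\<eta> (abs_eigvals x))"
    by (rule vec_norm_weakly_majorized[OF abs_eigvals_nonneg_decr
          cw_prod_nonneg_decr[OF \<eta> abs_eigvals_nonneg_decr] jrank_pos maj exponents(1)])
  also have "\<dots> \<le> vec_norm r ?\<eta> * vec_norm s (abs_eigvals x)"
    using len jrank_pos by (intro holder_vec_norm exponents) auto
  also have "vec_norm s (abs_eigvals x) = spectral_norm jp e s x"
    by (rule spectral_norm_abs[symmetric])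
  finally show ?thesis .
qed

end
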